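(* Let $n\ge1$ and let $\Gamma_n$, $d$, $\Lambda_n$ and the labeling $p\mapsto\sigma_p$ be as follows: $\Gamma_n$ is the Cayley graph of $S_n$ generated by all transpositions with graph metric $d$; $\Lambda_n$ is the set of permutations $\sigma_p$ where $p$ ranges over noncrossing partitions of $\{1,\dots,n\}$ and $\sigma_p$ has as cycles the blocks of $p$, each written in increasing order; and $d_\Lambda(\sigma,\tau)$ is the length of a shortest path from $\sigma$ to $\tau$ in the Hasse diagram of the refinement order on noncrossing partitions (equivalently, a shortest path in $\Gamma_n$ all of whose vertices lie in $\Lambda_n$). For $\sigma,\tau\in\Lambda_n$, place $2n$ points on a horizontal line in the order $L_1,R_1,L_2,R_2,\dots,L_n,R_n$; in the upper half-plane draw pairwise disjoint arcs joining $R_i$ to $L_{\sigma(i)}$ for each $i$, and in the lower half-plane draw pairwise disjoint arcs joining $R_i$ to $L_{\tau(i)}$ for each $i$ (this is possible since $\sigma,\tau\in\Lambda_n$). The union is a disjoint collection of simple closed curves (a system of meanders); let $\Pi_0(\sigma,\tau)$ be the number of its connected components. Then for any $\sigma,\tau\in\Lambda_n$ and any integer $k$, the following are equivalent: (1) $\Pi_0(\sigma,\tau)=k$; (2) $d(\sigma,\tau)=n-k$; (3) $d_\Lambda(\sigma,\tau)=n-k$. In particular, $(\sigma,\tau)$ determines a meander (a single closed curve) if and only if $d(\sigma,\tau)=d_\Lambda(\sigma,\tau)=n-1$.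
   Context: A partition of $\{1,\dots,n\}$ is noncrossing if whenever $i<j<k<\ell$ with $i\sim k$ and $j\sim\ell$, all four lie in one block. The refinement order: $p\preceq q$ if each block of $p$ lies in a block of $q$; the Hasse diagram joins $p,q$ when one covers the other (differs by splitting one block into two). Permutations act on the left (composition right-to-left). The points $L_i,R_i$ are the $2n$ transverse intersection points of the curves with the horizontal line. *)

theory Defs
  imports "HOL-Analysis.Analysis" "HOL-Combinatorics.Combinatorics"
begin

definition noncrossing :: "nat set set \<Rightarrow> bool" where
  "noncrossing p \<longleftrightarrow>
     (\<forall>i j k l. i < j \<and> j < k \<and> k < l \<and>
        (\<exists>B\<in>p. i \<in> B \<and> k \<in> B) \<and> (\<exists>C\<in>p. j \<in> C \<and> l \<in> C) \<longrightarrow>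
        (\<exists>D\<in>p. {i, j, k, l} \<subseteq> D))"

definition NC :: "nat \<Rightarrow> nat set set set" where
  "NC n = {p. partition_on {1..n} p \<and> noncrossing p}"

text \<open>The union below is the block of \<^term>\<open>p\<close> containing \<^term>\<open>i\<close>, or empty
  (whence \<^term>\<open>i\<close> is fixed) if there is none.  \<^const>\<open>cycle_of_list\<close> sends
  each list entry to its successor and the last entry to the first.\<close>

definition sigma :: "nat set set \<Rightarrow> nat \<Rightarrow> nat" where
  "sigma p i = cycle_of_list (sorted_list_of_set (\<Union>{B\<in>p. i \<in> B})) i"

definition Lambda :: "nat \<Rightarrow> (nat \<Rightarrow> nat) set" where
  "Lambda n = sigma ` NC n"

text \<open>Length of a shortest path in the graph with symmetric edge relation \<^term>\<open>E\<close>.  This is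
  only meaningful for vertices in the same connected component; the graphs below are
  connected (on the vertex sets of all permutations, respectively \<^const>\<open>Lambda\<close>).\<close>

definition graph_dist :: "('a \<times> 'a) set \<Rightarrow> 'a \<Rightarrow> 'a \<Rightarrow> nat" where
  "graph_dist E x y = (LEAST m. (x, y) \<in> E ^^ m)"

definition cayley_edges :: "nat \<Rightarrow> ((nat \<Rightarrow> nat) \<times> (nat \<Rightarrow> nat)) set" where
  "cayley_edges n =
     {(\<sigma>, \<sigma> \<circ> Transposition.transpose a b) | \<sigma> a b.
        \<sigma> permutes {1..n} \<and> a \<in> {1..n} \<and> b \<in> {1..n} \<and> a \<noteq> b}"

definition cayley_dist :: "nat \<Rightarrow> (nat \<Rightarrow> nat) \<Rightarrow> (nat \<Rightarrow> nat) \<Rightarrow> nat" where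
  "cayley_dist n = graph_dist (cayley_edges n)"

definition NC_less :: "nat \<Rightarrow> nat set set \<Rightarrow> nat set set \<Rightarrow> bool" where
  "NC_less n p q \<longleftrightarrow> p \<in> NC n \<and> q \<in> NC n \<and> refines {1..n} p q \<and> p \<noteq> q"

definition NC_covered :: "nat \<Rightarrow> nat set set \<Rightarrow> nat set set \<Rightarrow> bool" where
  "NC_covered n p q \<longleftrightarrow> NC_less n p q \<and> (\<nexists>r. NC_less n p r \<and> NC_less n r q)"

text \<open>The Hasse diagram, with each vertex \<^term>\<open>p\<close> labeled by \<^term>\<open>sigma p\<close>.\<close>

definition hasse_edges :: "nat \<Rightarrow> ((nat \<Rightarrow> nat) \<times> (nat \<Rightarrow> nat)) set" where
  "hasse_edges n = {(sigma p, sigma q) | p q. NC_covered n p q \<or> NC_covered n q p}"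

definition Lambda_dist :: "nat \<Rightarrow> (nat \<Rightarrow> nat) \<Rightarrow> (nat \<Rightarrow> nat) \<Rightarrow> nat" where
  "Lambda_dist n = graph_dist (hasse_edges n)"

text \<open>The horizontal line is the real axis of the complex plane; the points occur on it in the
  order \<open>L 1, R 1, L 2, R 2, \<dots>, L n, R n\<close>.\<close>

definition meander_points :: "nat \<Rightarrow> (nat \<Rightarrow> real) \<Rightarrow> (nat \<Rightarrow> real) \<Rightarrow> bool" where
  "meander_points n L R \<longleftrightarrow>
     (\<forall>i\<in>{1..n}. L i < R i) \<and> (\<forall>i\<in>{1..<n}. R i < L (Suc i))"

definition arc_family ::
  "nat \<Rightarrow> (nat \<Rightarrow> real) \<Rightarrow> (nat \<Rightarrow> real) \<Rightarrow> complex set \<Rightarrow> (nat \<Rightarrow> nat) \<Rightarrow>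
    (nat \<Rightarrow> real \<Rightarrow> complex) \<Rightarrow> bool" where
  "arc_family n L R H \<sigma> g \<longleftrightarrow>
     (\<forall>i\<in>{1..n}. arc (g i) \<and>
        pathstart (g i) = complex_of_real (R i) \<and>
        pathfinish (g i) = complex_of_real (L (\<sigma> i)) \<and>
        path_image (g i) - {pathstart (g i), pathfinish (g i)} \<subseteq> H) \<and>
     disjoint_family_on (\<lambda>i. path_image (g i)) {1..n}"

definition meander_drawing ::
  "nat \<Rightarrow> (nat \<Rightarrow> real) \<Rightarrow> (nat \<Rightarrow> real) \<Rightarrow> (nat \<Rightarrow> nat) \<Rightarrow> (nat \<Rightarrow> nat) \<Rightarrow>
    (nat \<Rightarrow> real \<Rightarrow> complex) \<Rightarrow> (nat \<Rightarrow> real \<Rightarrow> complex) \<Rightarrow> bool" where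
  "meander_drawing n L R \<sigma> \<tau> u l \<longleftrightarrow>
     arc_family n L R {z. Im z > 0} \<sigma> u \<and> arc_family n L R {z. Im z < 0} \<tau> l"

definition meander_system ::
  "nat \<Rightarrow> (nat \<Rightarrow> real \<Rightarrow> complex) \<Rightarrow> (nat \<Rightarrow> real \<Rightarrow> complex) \<Rightarrow> complex set" where
  "meander_system n u l = (\<Union>i\<in>{1..n}. path_image (u i) \<union> path_image (l i))"

definition simple_closed_curve :: "complex set \<Rightarrow> bool" where
  "simple_closed_curve C \<longleftrightarrow>
     (\<exists>g. simple_path g \<and> pathfinish g = pathstart g \<and> path_image g = C)"

end

theory Submission
  imports Defs
begin

text \<open>
  All the distances equal \<open>n - c\<close>, where \<open>c\<close> is the number of cycles of
  \<open>\<tau>\<inverse> \<circ> \<sigma>\<close>.  A transposition changes the number of cycles by at most one, which gives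
  the lower bound already in the Cayley graph.  For the upper bound, take the shortest arc
  \<open>R i -- L (\<sigma> i)\<close> of \<open>\<sigma>\<close> that is not an arc of \<open>\<tau>\<close>; since \<open>\<sigma>\<close> and \<open>\<tau>\<close> agree on the
  points it encloses, it can be inserted into the diagram of \<open>\<tau>\<close> by merging two blocks or cutting one
  block.  This is one step in the Hasse diagram, and it splits off the fixed point \<open>i\<close> from a cycle
  of \<open>\<tau>\<inverse> \<circ> \<sigma>\<close>.  Following a curve of the drawing from \<open>R i\<close> through the upper and then
  the lower half-plane leads to \<open>R (\<tau>\<inverse> (\<sigma> i))\<close>, so that the curves correspond to these cycles.
\<close>


subsection \<open>Cyclic successors in a block\<close>

text \<open>Minimality of the arc matters because an arbitrary arc of \<open>\<sigma>\<close> may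
  cross arcs of \<open>\<tau>\<close>, and then a single merge or cut need not give a noncrossing
  partition containing it. Arcs nested inside a shortest missing one are shorter, hence common to
  both diagrams. The Hasse diagram is defined through the order, so its edges must be recognised as
  transpositions. A cover merges exactly two blocks, because any larger coarsening leaves room for a
  noncrossing partition in between, found by cutting a block along an interval. The Cayley bound and
  the Hasse paths then squeeze the distance in every graph lying between the two, in particular in
  the subgraph induced on \<open>Lambda n\<close>. The statement concerns all drawings, not a chosen
  one. The component count therefore rests on end points, disjointness and half-planes alone;
  explicit semicircles serve to show that a drawing exists.\<close>

definition is_nxt :: "nat set \<Rightarrow> nat \<Rightarrow> nat \<Rightarrow> bool" where
  "is_nxt B x y \<longleftrightarrow> x \<in> B \<and> y \<in> B \<and>
     ((x < y \<and> (\<forall>z\<in>B. \<not> (x < z \<and> z < y))) \<or> (y \<le> x \<and> (\<forall>z\<in>B. y \<le> z \<and> z \<le> x)))"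

lemma is_nxtD:
  assumes "is_nxt B x y"
  shows "x \<in> B" "y \<in> B"
    and "z \<in> B \<Longrightarrow> x < y \<and> \<not> (x < z \<and> z < y) \<or> y \<le> x \<and> y \<le> z \<and> z \<le> x"
  using assms unfolding is_nxt_def by auto

lemma is_nxt_unique:
  assumes "is_nxt B x y" "is_nxt B x z" shows "y = z"
proof -
  have "y \<in> B" "z \<in> B" using assms is_nxtD by auto
  then show ?thesis using is_nxtD(3)[OF assms(1), of z] is_nxtD(3)[OF assms(2), of y] by linarith
qed

lemma is_nxt_unique_left:
  assumes "is_nxt B x z" "is_nxt B y z" shows "x = y"
proof -
  have "x \<in> B" "y \<in> B" using assms is_nxtD by auto
  then show ?thesis using is_nxtD(3)[OF assms(1), of y] is_nxtD(3)[OF assms(2), of x] by linarith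
qed

text \<open>Trades list positions for order conditions within reach of linear arithmetic. The second
  disjunct of \<open>is_nxt\<close> is the wrap from maximum to minimum; it also covers
  singletons.\<close>

lemma is_nxt_cycle_of_list:
  assumes "finite B" "x \<in> B"
  shows "is_nxt B x (cycle_of_list (sorted_list_of_set B) x)"
proof -
  define cs where "cs = sorted_list_of_set B"
  have cs: "distinct cs" "sorted cs" "set cs = B" "sorted_wrt (<) cs"
    using assms strict_sorted_iff[of cs] by (auto simp: cs_def)
  obtain k where k: "k < length cs" "x = cs ! k"
    using assms(2) unfolding cs(3)[symmetric] in_set_conv_nth by blast
  have "map (cycle_of_list cs) cs = rotate1 cs"
    using cyclic_rotation[of cs 1] cs by simp
  then have nx: "cycle_of_list cs x = cs ! (Suc k mod length cs)"
    using k by (metis nth_map nth_rotate1)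
  have index: "\<exists>m<length cs. z = cs ! m" if "z \<in> B" for z
    using that cs(3) by (metis in_set_conv_nth)
  have mono: "cs ! a < cs ! b \<longleftrightarrow> a < b" if "a < length cs" "b < length cs" for a b
    using sorted_wrt_nth_less[OF cs(4), of a b] sorted_wrt_nth_less[OF cs(4), of b a] that
    by (cases a b rule: linorder_cases) auto
  have "is_nxt B x (cs ! (Suc k mod length cs))"
  proof (cases "Suc k < length cs")
    case True
    have "\<not> (x < z \<and> z < cs ! Suc k)" if z: "z \<in> B" for z
    proof -
      obtain m where "m < length cs" "z = cs ! m"
        using index[OF z] by blast
      then show ?thesis using mono[of k m] mono[of m "Suc k"] k True by simp
    qed
    then show ?thesis using True k cs mono[of k "Suc k"] unfolding is_nxt_def by auto
  next
    case False
    then have l: "length cs = Suc k" using k by simp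
    have "cs ! 0 \<le> z \<and> z \<le> x" if z: "z \<in> B" for z
    proof -
      obtain m where "m < length cs" "z = cs ! m"
        using index[OF z] by blast
      then show ?thesis using mono[of m 0] mono[of k m] k l by (simp add: not_less[symmetric])
    qed
    then show ?thesis using l k cs unfolding is_nxt_def by auto
  qed
  then show ?thesis using nx by (simp add: cs_def)
qed

lemma Union_blocks_eq:
  assumes "partition_on S p" "B \<in> p" "x \<in> B"
  shows "\<Union>{B\<in>p. x \<in> B} = B"
proof -
  have "C = B" if "C \<in> p" "x \<in> C" for C
    using assms that by (auto simp: partition_on_def disjoint_def)
  then show ?thesis using assms(2,3) by blast
qed

lemma is_nxt_sigma:
  assumes "partition_on S p" "finite S" "B \<in> p" "x \<in> B"
  shows "is_nxt B x (sigma p x)"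
proof -
  have "B \<subseteq> S" using assms(1,3) by (auto simp: partition_on_def)
  then show ?thesis
    unfolding sigma_def Union_blocks_eq[OF assms(1,3,4)]
    using assms finite_subset by (intro is_nxt_cycle_of_list) blast+
qed

lemma sigma_eqI:
  assumes "partition_on S p" "finite S" "B \<in> p" "is_nxt B x y"
  shows "sigma p x = y"
  using is_nxt_unique[OF is_nxt_sigma[OF assms(1-3) is_nxtD(1)[OF assms(4)]] assms(4)] .

lemma sigma_outside:
  assumes "partition_on S p" "x \<notin> S" shows "sigma p x = x"
proof -
  have "{B\<in>p. x \<in> B} = {}" using assms by (auto simp: partition_on_def)
  then show ?thesis by (simp only: sigma_def) simp
qed

lemma block_of:
  assumes "partition_on S p" "x \<in> S"
  obtains B where "B \<in> p" "x \<in> B"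
  using assms by (auto simp: partition_on_def)

lemma sigma_in_block:
  assumes "partition_on S p" "finite S" "B \<in> p" "x \<in> B"
  shows "sigma p x \<in> B"
  using is_nxt_sigma[OF assms] by (simp add: is_nxt_def)

lemma block_eq:
  assumes "partition_on S p" "B \<in> p" "C \<in> p" "x \<in> B" "x \<in> C"
  shows "B = C"
  using assms by (auto simp: partition_on_def disjoint_def)

lemma sigma_permutes:
  assumes p: "partition_on S p" and S: "finite S"
  shows "sigma p permutes S"
proof (rule bij_imp_permutes)
  have in_S: "sigma p x \<in> S" if "x \<in> S" for x
    using block_of[OF p that] sigma_in_block[OF p S] p by (metis UnionI partition_onD1)
  have inj: "inj_on (sigma p) S"
  proof (rule inj_onI)
    fix x y assume xy: "x \<in> S" "y \<in> S" "sigma p x = sigma p y"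
    obtain B C where B: "B \<in> p" "x \<in> B" and C: "C \<in> p" "y \<in> C"
      using block_of[OF p] xy by metis
    have "B = C"
      using sigma_in_block[OF p S B] sigma_in_block[OF p S C] xy block_eq[OF p] B C by metis
    then show "x = y"
      using is_nxt_sigma[OF p S B] is_nxt_sigma[OF p S C] xy is_nxt_unique_left by metis
  qed
  show "bij_betw (sigma p) S S"
    unfolding bij_betw_def using in_S inj endo_inj_surj[OF S _ inj] by blast
  show "sigma p x = x" if "x \<notin> S" for x
    using sigma_outside[OF p that] .
qed


subsection \<open>Merging two blocks\<close>

text \<open>Disjointness of blocks sharpens the common block \<open>D\<close> in
  \<open>noncrossing\<close> to equality of the two crossing blocks.\<close>

lemma noncrossing_blocks_eq:
  assumes "partition_on S p" "noncrossing p" "B \<in> p" "C \<in> p"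
    and "i \<in> B" "k \<in> B" "j \<in> C" "l \<in> C" "i < j" "j < k" "k < l"
  shows "B = C"
proof -
  obtain D where D: "D \<in> p" "{i, j, k, l} \<subseteq> D"
    using assms(2-) unfolding noncrossing_def by blast
  have "B = D" using D assms by (intro block_eq[OF assms(1), of B D i]) auto
  moreover have "C = D" using D assms by (intro block_eq[OF assms(1), of C D j]) auto
  ultimately show ?thesis by simp
qed

lemma noncrossingI:
  assumes "\<And>B C i j k l. \<lbrakk>B \<in> p; C \<in> p; B \<noteq> C; i \<in> B; k \<in> B; j \<in> C; l \<in> C; i < j; j < k; k < l\<rbrakk> \<Longrightarrow> False"
  shows "noncrossing p"
  unfolding noncrossing_def
proof (intro allI impI, elim conjE bexE)
  fix i j k l B C
  assume *: "i < j" "j < k" "k < l" "B \<in> p" "i \<in> B" "k \<in> B" "C \<in> p" "j \<in> C" "l \<in> C"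
  then have "B = C" using assms by blast
  then show "\<exists>D\<in>p. {i, j, k, l} \<subseteq> D" using * by blast
qed

definition merge :: "'a set \<Rightarrow> 'a set \<Rightarrow> 'a set set \<Rightarrow> 'a set set" where
  "merge A B p = insert (A \<union> B) (p - {A, B})"

lemma merge_commute: "merge A B p = merge B A p"
  by (simp add: merge_def Un_commute insert_commute)

lemma partition_on_blocks:
  assumes "partition_on S p" "A \<in> p" "B \<in> p" "A \<noteq> B"
  shows "A \<noteq> {}" "A \<subseteq> S" "A \<inter> B = {}"
  using assms by (auto simp: partition_on_def disjoint_def)

lemma finite_block:
  assumes "partition_on S p" "finite S" "A \<in> p" shows "finite A"
  using assms by (metis Union_upper finite_subset partition_onD1)

lemma partition_on_merge:
  assumes p: "partition_on S p" and AB: "A \<in> p" "B \<in> p"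
  shows "partition_on S (merge A B p)"
proof (rule partition_onI)
  show "\<Union>(merge A B p) = S"
    using p AB by (auto simp: merge_def partition_on_def)
  show "{} \<notin> merge A B p"
    using p AB by (auto simp: merge_def partition_on_def)
  have d: "disjnt (A \<union> B) X" if "X \<in> p - {A, B}" for X
    using p AB that by (auto simp: partition_on_def pairwise_def disjnt_def)
  show "disjnt X Y" if "X \<in> merge A B p" "Y \<in> merge A B p" "X \<noteq> Y" for X Y
  proof -
    consider "X = A \<union> B" "Y \<in> p - {A, B}" | "Y = A \<union> B" "X \<in> p - {A, B}" | "X \<in> p" "Y \<in> p"
      using \<open>X \<in> _\<close> \<open>Y \<in> _\<close> \<open>X \<noteq> Y\<close> unfolding merge_def by blast
    then show ?thesis
      using d disjnt_sym pairwiseD[OF partition_onD2[OF p]] \<open>X \<noteq> Y\<close> by cases blast+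
  qed
qed

lemma card_merge:
  assumes "partition_on S p" "finite p" "A \<in> p" "B \<in> p" "A \<noteq> B"
  shows "card p = Suc (card (merge A B p))"
proof -
  \<comment> \<open>A block \<open>A \<union> B\<close> other than \<open>A\<close> would have to be
    disjoint from the nonempty \<open>A\<close>.\<close>
  have "A \<union> B \<notin> p - {A, B}"
  proof
    assume *: "A \<union> B \<in> p - {A, B}"
    have "A \<noteq> {}" using assms partition_on_blocks by blast
    then show False using * assms partition_on_blocks(3)[OF assms(1,3), of "A \<union> B"] by auto
  qed
  then have "card (merge A B p) = Suc (card (p - {A, B}))"
    using assms by (simp add: merge_def)
  moreover have "card (p - {A, B}) = card p - 2"
    using assms by (subst card_Diff_subset) auto
  moreover have "2 \<le> card p"
    using card_mono[of p "{A, B}"] assms by auto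
  ultimately show ?thesis by simp
qed

lemma refines_merge:
  assumes "partition_on S p" "A \<in> p" "B \<in> p"
  shows "refines S p (merge A B p)"
  unfolding refines_def
proof (intro conjI ballI)
  show "\<exists>Y\<in>merge A B p. X \<subseteq> Y" if "X \<in> p" for X
    using that by (cases "X \<in> {A, B}") (auto simp: merge_def)
qed (use assms partition_on_merge[OF assms] in auto)

text \<open>The number of blocks drops strictly under proper coarsening. Sending a block of
  \<open>p\<close> to the block of \<open>q\<close> around it is surjective, hence injective under
  the cardinality hypothesis, and then a block of \<open>q\<close> has no room for points of a
  second block of \<open>p\<close>.\<close>

lemma refines_card_eq:
  assumes r: "refines S p q" and S: "finite S" and c: "card p \<le> card q"
  shows "p = q"
proof -
  have p: "partition_on S p" and q: "partition_on S q" using r by (auto simp: refines_def)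
  have fp: "finite p" and fq: "finite q" using finite_elements[OF S p] finite_elements[OF S q] .
  obtain f where f: "\<And>X. X \<in> p \<Longrightarrow> f X \<in> q \<and> X \<subseteq> f X"
    using r unfolding refines_def by metis
  have surj: "Y \<in> f ` p" if Y: "Y \<in> q" for Y
  proof -
    obtain y where y: "y \<in> Y" using partition_onD3[OF q] Y by (cases "Y = {}") auto
    then have "y \<in> S" using partition_onD1[OF q] Y by blast
    then obtain X where X: "X \<in> p" "y \<in> X" using block_of[OF p] by blast
    have "f X = Y" using block_eq[OF q _ Y] f X y by blast
    then show ?thesis using X by blast
  qed
  have fpq: "f ` p = q" using surj f by blast
  then have "inj_on f p" using c fp by (intro eq_card_imp_inj_on) (auto intro: antisym card_image_le)
  have "X \<in> q" if X: "X \<in> p" for X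
  proof -
    have "f X \<subseteq> X"
    proof
      fix y assume y: "y \<in> f X"
      then have "y \<in> S" using q f X by (auto simp: partition_on_def)
      then obtain Z where Z: "Z \<in> p" "y \<in> Z" using block_of[OF p] by blast
      then have "f Z = f X" using block_eq[OF q] f X y by blast
      then have "Z = X" using \<open>inj_on f p\<close> Z X by (auto dest: inj_onD)
      then show "y \<in> X" using Z by simp
    qed
    then have "f X = X" using f[OF X] by blast
    then show ?thesis using f[OF X] by simp
  qed
  then show ?thesis using card_seteq[OF fq, of p] c fp fq card_image_le[OF fp, of f] fpq by blast
qed

text \<open>Since \<open>B\<close> holds the least element, noncrossing puts all of \<open>A\<close>
  into one gap of \<open>B\<close>, right after \<open>k\<close>. The merged cycle enters
  \<open>A\<close> from \<open>k\<close> and leaves it at \<open>b = Max A\<close> towards the old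
  successor of \<open>k\<close>. The successors of \<open>b\<close> and \<open>k\<close> are
  exchanged and all others survive, which makes a merge a transposition.\<close>

lemma is_nxt_Un:
  assumes fin: "finite A" "finite B" and ne: "A \<noteq> {}" and dis: "A \<inter> B = {}"
    and mB: "m \<in> B" and mle: "\<forall>x\<in>A \<union> B. m \<le> x"
    and nc: "\<forall>i\<in>B. \<forall>j\<in>A. \<forall>k\<in>B. \<forall>l\<in>A. \<not> (i < j \<and> j < k \<and> k < l)"
  shows "\<exists>b\<in>A. \<exists>k\<in>B.
    (\<forall>y. is_nxt A b y \<longrightarrow> is_nxt (A \<union> B) k y) \<and> (\<forall>y. is_nxt B k y \<longrightarrow> is_nxt (A \<union> B) b y) \<and>
    (\<forall>x y. is_nxt A x y \<longrightarrow> x \<noteq> b \<longrightarrow> is_nxt (A \<union> B) x y) \<and>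
    (\<forall>x y. is_nxt B x y \<longrightarrow> x \<noteq> k \<longrightarrow> is_nxt (A \<union> B) x y)"
proof -
  have m: "m \<in> B" "\<And>x. x \<in> A \<union> B \<Longrightarrow> m \<le> x" using mB mle by blast+
  define a where "a = Min A"
  define b where "b = Max A"
  define k where "k = Max {z \<in> B. z < a}"
  have a: "a \<in> A" "\<And>x. x \<in> A \<Longrightarrow> a \<le> x" and b: "b \<in> A" "\<And>x. x \<in> A \<Longrightarrow> x \<le> b"
    using fin ne by (auto simp: a_def b_def)
  have "m \<noteq> a" using dis a m by blast
  then have ma: "m < a" using m(2)[of a] a(1) by simp
  then have "{z \<in> B. z < a} \<noteq> {}" using m by blast
  then have "k \<in> {z \<in> B. z < a}" unfolding k_def using fin by (intro Max_in) auto
  then have k: "k \<in> B" "k < a" by auto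
  have kmax: "z \<le> k" if "z \<in> B" "z < a" for z
    unfolding k_def using fin that by (intro Max_ge) auto
  \<comment> \<open>A point of \<open>B\<close> inside the span of \<open>A\<close> would give the
    forbidden pattern \<open>m < a < z < b\<close>.\<close>
  have out: "z \<le> k \<or> b < z" if z: "z \<in> B" for z
  proof (rule ccontr)
    assume "\<not> (z \<le> k \<or> b < z)"
    then have "a \<le> z" "z \<le> b" using kmax[OF z] by linarith+
    moreover have "z \<noteq> a" "z \<noteq> b" using z a b dis by blast+
    ultimately have "a < z" "z < b" by auto
    then show False using nc m(1) a(1) z b(1) ma by blast
  qed
  show ?thesis
  proof (intro bexI[OF _ b(1)] bexI[OF _ k(1)] conjI allI impI)
    fix y assume y: "is_nxt A b y"
    have "y = a" using is_nxtD[OF y] is_nxtD(3)[OF y a(1)] a b by (meson order.antisym not_le le_trans)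
    moreover have "\<not> (k < z \<and> z < a)" if "z \<in> A \<union> B" for z
      using that a(2) kmax by (meson UnE not_le)
    ultimately show "is_nxt (A \<union> B) k y"
      using k a unfolding is_nxt_def by blast
  next
    fix y assume y: "is_nxt B k y"
    show "is_nxt (A \<union> B) b y"
    \<comment> \<open>Either \<open>y\<close> is the next point of \<open>B\<close> beyond
      \<open>A\<close>, or \<open>k\<close> is the last point of \<open>B\<close> and the cycle
      wraps around, so that \<open>b\<close> is the maximum of the union.\<close>
    proof (cases "k < y")
      case True
      have "b < y" using out is_nxtD(2)[OF y] True by (meson not_le)
      moreover have "\<not> (b < z \<and> z < y)" if "z \<in> A \<union> B" for z
        using that
      proof
        assume "z \<in> B"
        then show ?thesis using is_nxtD(3)[OF y, of z] True k(2) a(2)[OF b(1)] by linarith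
      qed (use b(2) in \<open>auto simp: not_le dest: leD\<close>)
      ultimately show ?thesis using b(1) is_nxtD(2)[OF y] unfolding is_nxt_def by blast
    next
      case False
      have "y \<le> z \<and> z \<le> b" if "z \<in> A \<union> B" for z
        using that
      proof
        assume z: "z \<in> B"
        then show ?thesis using is_nxtD(3)[OF y z] False k(2) a(2)[OF b(1)] by linarith
      next
        assume z: "z \<in> A"
        then show ?thesis using is_nxtD(3)[OF y m(1)] False ma a(2)[OF z] b(2)[OF z] by linarith
      qed
      moreover have "y \<le> b" using False k(2) a(2)[OF b(1)] by linarith
      ultimately show ?thesis using b(1) is_nxtD(2)[OF y] unfolding is_nxt_def by blast
    qed
  next
    fix x y assume y: "is_nxt A x y" and x: "x \<noteq> b"
    have xA: "x \<in> A" and yA: "y \<in> A" using is_nxtD[OF y] by auto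
    have xy: "x < y" using is_nxtD(3)[OF y b(1)] b(2)[OF xA] x by linarith
    have "\<not> (x < z \<and> z < y)" if "z \<in> A \<union> B" for z
      using that
    proof
      assume "z \<in> A" then show ?thesis using is_nxtD(3)[OF y, of z] xy by linarith
    next
      assume "z \<in> B" then show ?thesis using out[of z] a(2)[OF xA] b(2)[OF yA] k(2) by linarith
    qed
    then show "is_nxt (A \<union> B) x y" using xA yA xy unfolding is_nxt_def by blast
  next
    fix x y assume y: "is_nxt B x y" and x: "x \<noteq> k"
    have xB: "x \<in> B" and yB: "y \<in> B" using is_nxtD[OF y] by auto
    show "is_nxt (A \<union> B) x y"
    proof (cases "x < y")
      case True
      have "\<not> (x < z \<and> z < y)" if "z \<in> A \<union> B" for z
        using that
      proof
        assume z: "z \<in> A"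
        show ?thesis
          using is_nxtD(3)[OF y k(1)] out[OF xB] out[OF yB] a(2)[OF z] b(2)[OF z] k(2) x True by linarith
      next
        assume "z \<in> B" then show ?thesis using is_nxtD(3)[OF y, of z] True by linarith
      qed
      then show ?thesis using xB yB True unfolding is_nxt_def by blast
    next
      case False
      have "y \<le> z \<and> z \<le> x" if "z \<in> A \<union> B" for z
        using that
      proof
        assume z: "z \<in> A"
        show ?thesis
          using is_nxtD(3)[OF y k(1)] is_nxtD(3)[OF y m(1)] out[OF xB] a(2)[OF z] b(2)[OF z] k(2) x ma False
          by linarith
      next
        assume "z \<in> B" then show ?thesis using is_nxtD(3)[OF y, of z] False by linarith
      qed
      then show ?thesis using xB yB False unfolding is_nxt_def by force
    qed
  qed
qed

lemma sigma_merge_aux: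
  assumes S: "finite S" and p: "partition_on S p" and nc: "noncrossing p"
    and AB: "A \<in> p" "B \<in> p" "A \<noteq> B" and m: "m \<in> B" "\<And>x. x \<in> A \<union> B \<Longrightarrow> m \<le> x"
  shows "\<exists>a\<in>A. \<exists>b\<in>B. sigma (merge A B p) = sigma p \<circ> Transposition.transpose a b"
proof -
  have fin: "finite A" "finite B"
    using finite_block[OF p S] AB by auto
  have dis: "A \<inter> B = {}" and ne: "A \<noteq> {}" using partition_on_blocks[OF p AB] by auto
  have q: "partition_on S (merge A B p)" using partition_on_merge[OF p AB(1,2)] .
  have ncAB: "\<forall>i\<in>B. \<forall>j\<in>A. \<forall>k\<in>B. \<forall>l\<in>A. \<not> (i < j \<and> j < k \<and> k < l)"
    using noncrossing_blocks_eq[OF p nc AB(2,1)] AB(3) by blast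
  obtain b k where bk: "b \<in> A" "k \<in> B"
    "\<And>y. is_nxt A b y \<Longrightarrow> is_nxt (A \<union> B) k y"
    "\<And>y. is_nxt B k y \<Longrightarrow> is_nxt (A \<union> B) b y"
    "\<And>x y. is_nxt A x y \<Longrightarrow> x \<noteq> b \<Longrightarrow> is_nxt (A \<union> B) x y"
    "\<And>x y. is_nxt B x y \<Longrightarrow> x \<noteq> k \<Longrightarrow> is_nxt (A \<union> B) x y"
    using is_nxt_Un[OF fin ne dis m(1) _ ncAB] m(2) by blast
  have M: "A \<union> B \<in> merge A B p" by (simp add: merge_def)
  have "sigma (merge A B p) x = sigma p (Transposition.transpose b k x)" for x
  proof -
    consider "x = b" | "x = k" | "x \<in> A" "x \<noteq> b" "x \<noteq> k" | "x \<in> B" "x \<noteq> b" "x \<noteq> k"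
      | "x \<notin> A" "x \<notin> B" by blast
    then show ?thesis
    proof cases
      case 1
      then show ?thesis
        using sigma_eqI[OF q S M bk(4)[OF is_nxt_sigma[OF p S AB(2) bk(2)]]] by simp
    next
      case 2
      then show ?thesis
        using sigma_eqI[OF q S M bk(3)[OF is_nxt_sigma[OF p S AB(1) bk(1)]]] by simp
    next
      case 3
      then show ?thesis
        using sigma_eqI[OF q S M bk(5)[OF is_nxt_sigma[OF p S AB(1)]]] by simp
    next
      case 4
      then show ?thesis
        using sigma_eqI[OF q S M bk(6)[OF is_nxt_sigma[OF p S AB(2)]]] by simp
    next
      case 5
      then have t: "Transposition.transpose b k x = x" using bk by (intro transpose_apply_other) auto
      show ?thesis
      proof (cases "x \<in> S")
        case True
        then obtain X where X: "X \<in> p" "x \<in> X" using block_of[OF p] by blast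
        then have "X \<in> merge A B p" using 5 by (auto simp: merge_def)
        then show ?thesis using sigma_eqI[OF q S _ is_nxt_sigma[OF p S X]] t by simp
      next
        case False
        then show ?thesis using sigma_outside[OF q False] sigma_outside[OF p False] t by simp
      qed
    qed
  qed
  then show ?thesis using bk by (intro bexI[of _ b] bexI[of _ k]) auto
qed

text \<open>Whichever block contains the minimum of the union plays the surrounding role; the other
  case follows from the symmetry of \<open>merge\<close> and \<open>transpose\<close>.\<close>

lemma sigma_merge:
  assumes S: "finite S" and p: "partition_on S p" and nc: "noncrossing p"
    and AB: "A \<in> p" "B \<in> p" "A \<noteq> B"
  obtains a b where "a \<in> A" "b \<in> B" "sigma (merge A B p) = sigma p \<circ> Transposition.transpose a b"
proof -
  have fin: "finite (A \<union> B)"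
    using finite_block[OF p S] AB by auto
  have ne: "A \<union> B \<noteq> {}" using partition_on_blocks[OF p AB] by auto
  define m where "m = Min (A \<union> B)"
  have m: "m \<in> A \<union> B" "\<And>x. x \<in> A \<union> B \<Longrightarrow> m \<le> x" 
    unfolding m_def using Min_in[OF fin ne] Min_le[OF fin] by blast+
  show ?thesis
  proof (cases "m \<in> B")
    case True
    then show ?thesis using sigma_merge_aux[OF S p nc AB True m(2)] that by blast
  next
    case False
    then have "m \<in> A" using m by blast
    then show ?thesis using sigma_merge_aux[OF S p nc AB(2,1) AB(3)[symmetric] _ m(2)] that
      by (metis merge_commute sup_commute transpose_commute)
  qed
qed

subsection \<open>The covering relation\<close>

lemma NCD: "p \<in> NC n \<Longrightarrow> partition_on {1..n} p" "p \<in> NC n \<Longrightarrow> noncrossing p"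
  by (auto simp: NC_def)

text \<open>A partition strictly in between would need a number of blocks strictly between two
  consecutive integers.\<close>

lemma NC_covered_merge:
  assumes p: "p \<in> NC n" and q: "merge A B p \<in> NC n" and AB: "A \<in> p" "B \<in> p" "A \<noteq> B"
  shows "NC_covered n p (merge A B p)"
proof -
  note pp = NCD(1)[OF p]
  have fp: "finite p" using finite_elements[OF finite_atLeastAtMost pp] .
  note c = card_merge[OF pp fp AB]
  have "NC_less n p (merge A B p)"
    using p q refines_merge[OF pp AB(1,2)] c by (auto simp: NC_less_def)
  moreover have False if r: "NC_less n p r" "NC_less n r (merge A B p)" for r
  proof -
    have "card r < card p"
      using r(1) refines_card_eq[of "{1..n}" p r] unfolding NC_less_def by force
    moreover have "card (merge A B p) < card r"
      using r(2) refines_card_eq[of "{1..n}" r "merge A B p"] unfolding NC_less_def by force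
    ultimately show False using c by simp
  qed
  ultimately show ?thesis unfolding NC_covered_def by blast
qed

text \<open>Recovering \<open>q\<close> as a merge lets every cut be treated as a merge read
  backwards.\<close>

lemma partition_on_cut:
  assumes q: "partition_on S q" and Q: "Q \<in> q" and ne: "Q \<inter> I \<noteq> {}" "Q - I \<noteq> {}"
    and r: "r = insert (Q \<inter> I) (insert (Q - I) (q - {Q}))"
  shows "partition_on S r" "merge (Q \<inter> I) (Q - I) r = q"
proof -
  have d: "X \<inter> Q = {}" if "X \<in> q" "X \<noteq> Q" for X
    using partition_on_blocks(3)[OF q that(1) Q that(2)] .
  have nin: "Q \<inter> I \<notin> q - {Q}" "Q - I \<notin> q - {Q}" using d[of "Q \<inter> I"] d[of "Q - I"] ne by auto
  moreover have "Q \<inter> I \<union> (Q - I) = Q" by blast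
  ultimately show "merge (Q \<inter> I) (Q - I) r = q" unfolding merge_def r using Q by auto
  show "partition_on S r"
  proof (rule partition_onI)
    show "\<Union>r = S" unfolding r partition_onD1[OF q] using Q by auto
    show "{} \<notin> r" using ne partition_onD3[OF q] unfolding r by auto
    show "disjnt X Y" if X: "X \<in> r" and Y: "Y \<in> r" and XY: "X \<noteq> Y" for X Y
    proof -
      have "disjnt X Y" if "X \<in> q" "Y \<in> q" using pairwiseD[OF partition_onD2[OF q] that XY] .
      moreover have "disjnt (Q \<inter> I) Z" "disjnt (Q - I) Z" if "Z \<in> q" "Z \<noteq> Q" for Z
        using d[OF that] by (auto simp: disjnt_def)
      moreover have "disjnt (Q \<inter> I) (Q - I)" by (auto simp: disjnt_def)
      ultimately show ?thesis using X Y XY unfolding r by (auto intro: disjnt_sym)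
    qed
  qed
qed

text \<open>Cutting along an interval is safe, because points inside and outside an interval cannot
  alternate twice. Crossing blocks of \<open>r\<close> lie in one block of \<open>q\<close>, so the
  two parts of \<open>Q\<close> are the only candidates for a crossing.\<close>

lemma NC_cut:
  assumes q: "q \<in> NC n" and Q: "Q \<in> q" and ne: "Q \<inter> {a..b} \<noteq> {}" "Q - {a..b} \<noteq> {}"
    and r: "r = insert (Q \<inter> {a..b}) (insert (Q - {a..b}) (q - {Q}))"
  shows "r \<in> NC n" "merge (Q \<inter> {a..b}) (Q - {a..b}) r = q"
proof -
  note pq = NCD(1)[OF q]
  note cut = partition_on_cut[OF pq Q ne r]
  show "merge (Q \<inter> {a..b}) (Q - {a..b}) r = q" using cut(2) .
  have "noncrossing r"
  proof (rule noncrossingI)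
    fix B C i j k l
    assume *: "B \<in> r" "C \<in> r" "B \<noteq> C" "i \<in> B" "k \<in> B" "j \<in> C" "l \<in> C" "i < j" "j < k" "k < (l::nat)"
    have r_cases: "X \<in> q \<and> X \<noteq> Q \<or> X = Q \<inter> {a..b} \<or> X = Q - {a..b}" if "X \<in> r" for X
      using that unfolding r by blast
    have sub: "\<exists>X'\<in>q. X \<subseteq> X'" if "X \<in> r" for X using r_cases[OF that] Q by blast
    obtain B' where B': "B' \<in> q" "B \<subseteq> B'" using sub[OF *(1)] by blast
    obtain C' where C': "C' \<in> q" "C \<subseteq> C'" using sub[OF *(2)] by blast
    have BC: "C' = B'"
      using noncrossing_blocks_eq[OF pq NCD(2)[OF q] B'(1) C'(1), of i k j l] * B' C' by blast
    show False
    proof (cases "B' = Q")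
      case True
      have "\<not> (X \<in> q \<and> X \<noteq> Q)" if "x \<in> X" "X \<subseteq> Q" for X x
        using block_eq[OF pq _ Q, of X x] that by blast
      then have "B = Q \<inter> {a..b} \<or> B = Q - {a..b}" "C = Q \<inter> {a..b} \<or> C = Q - {a..b}"
        using r_cases[OF *(1)] r_cases[OF *(2)] B' C' BC True * by blast+
      then show ?thesis using * by auto
    next
      case False
      have "X = B'" if X: "X \<in> r" "x \<in> X" "X \<subseteq> B'" for X x
      proof -
        have "X \<in> q" using r_cases[OF X(1)] block_eq[OF pq B'(1) Q, of x] False X by blast
        then show ?thesis using block_eq[OF pq _ B'(1), of X x] X by blast
      qed
      then have "B = B'" "C = B'" using * B' C' BC by blast+
      then show ?thesis using * by blast
    qed
  qed
  then show "r \<in> NC n" using cut(1) by (simp add: NC_def)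
qed

text \<open>A block \<open>Q\<close> of \<open>q\<close> that splits in \<open>p\<close> is cut
  along the span of a block \<open>A\<close> of \<open>p\<close> missing the minimum of
  \<open>Q\<close>. No block of \<open>p\<close> crosses \<open>A\<close>, so \<open>p\<close> still
  refines the result \<open>s\<close>, which lies strictly below \<open>q\<close>; covering forces
  \<open>p = s\<close>.\<close>

lemma NC_covered_imp_merge:
  assumes "NC_covered n p q"
  obtains A B where "A \<in> p" "B \<in> p" "A \<noteq> B" "q = merge A B p"
proof -
  have p: "p \<in> NC n" and q: "q \<in> NC n" and r: "refines {1..n} p q" and pq: "p \<noteq> q"
    using assms by (auto simp: NC_covered_def NC_less_def)
  note pp = NCD(1)[OF p] and qq = NCD(1)[OF q]
  have sub: "\<exists>Y\<in>q. X \<subseteq> Y" if "X \<in> p" for X using r that by (auto simp: refines_def)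
  have "\<not> q \<subseteq> p"
  proof
    assume "q \<subseteq> p"
    then have "card q \<le> card p" using finite_elements[OF _ pp] by (intro card_mono) auto
    moreover have "refines {1..n} q p" using \<open>q \<subseteq> p\<close> pp qq by (auto simp: refines_def)
    ultimately show False using pq refines_asym r by blast
  qed
  then obtain Q where Q: "Q \<in> q" "Q \<notin> p" by blast
  have finQ: "finite Q" "Q \<noteq> {}" using finite_block[OF qq _ Q(1)] partition_onD3[OF qq] Q by auto
  define m where "m = Min Q"
  have m: "m \<in> Q" "\<And>x. x \<in> Q \<Longrightarrow> m \<le> x" using finQ by (auto simp: m_def)
  have inS: "x \<in> {1..n}" if "x \<in> Q" for x using qq Q that unfolding partition_on_def by blast
  have subQ: "X \<subseteq> Q" if "X \<in> p" "x \<in> X" "x \<in> Q" for X x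
    using sub[OF that(1)] block_eq[OF qq Q(1)] that by blast
  obtain M where M: "M \<in> p" "m \<in> M" using block_of[OF pp inS[OF m(1)]] by blast
  have "M \<subseteq> Q" "M \<noteq> Q" using subQ M m Q by blast+
  then obtain x where x: "x \<in> Q" "x \<notin> M" by blast
  obtain A where A: "A \<in> p" "x \<in> A" using block_of[OF pp inS[OF x(1)]] by blast
  have AQ: "A \<subseteq> Q" using subQ A x by blast
  have AM: "A \<noteq> M" using A x by blast
  have finA: "finite A" "A \<noteq> {}" using AQ finQ A finite_subset by auto
  define a where "a = Min A"
  define b where "b = Max A"
  have a: "a \<in> A" and b: "b \<in> A" and ab: "\<And>y. y \<in> A \<Longrightarrow> a \<le> y \<and> y \<le> b"
    using finA by (auto simp: a_def b_def)
  \<comment> \<open>The minimum of \<open>Q\<close> lies left of \<open>a\<close>, so both parts of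
    the cut are nonempty.\<close>
  have "m \<notin> A" using block_eq[OF pp A(1) M(1)] AM M by blast
  then have "m < a" using m(2)[of a] a AQ by (metis le_neq_implies_less subset_iff)
  then have ne: "Q \<inter> {a..b} \<noteq> {}" "Q - {a..b} \<noteq> {}"
    using a ab[OF a] AQ m by auto
  define s where "s = insert (Q \<inter> {a..b}) (insert (Q - {a..b}) (q - {Q}))"
  note s = NC_cut[OF q Q(1) ne s_def]
  have "\<exists>Y\<in>s. X \<subseteq> Y" if X: "X \<in> p" for X
  proof -
    obtain Y where Y: "Y \<in> q" "X \<subseteq> Y" using sub[OF X] by blast
    consider "Y \<noteq> Q" | "X = A" | "Y = Q" "X \<noteq> A" by blast
    then show ?thesis
    proof cases
      case 1 then show ?thesis using Y s_def by blast
    next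
      case 2
      then have "X \<subseteq> Q \<inter> {a..b}" using AQ ab by auto
      then show ?thesis unfolding s_def by blast
    next
      case 3
      \<comment> \<open>A block meeting both the interval and its complement would cross
        \<open>A\<close>, whose extreme points are \<open>a\<close> and \<open>b\<close>.\<close>
      have "False" if x1: "x1 \<in> X" "x1 \<in> {a..b}" and x2: "x2 \<in> X" "x2 \<notin> {a..b}" for x1 x2
      proof -
        have "a \<noteq> x1" "b \<noteq> x1" using block_eq[OF pp X A(1)] 3 a b x1 by blast+
        then have "a < x1" "x1 < b" using x1 by auto
        moreover have "x2 < a \<or> b < x2" using x2 by auto
        ultimately show False
          using noncrossing_blocks_eq[OF pp NCD(2)[OF p] X A(1), of x2 x1 a b]
            noncrossing_blocks_eq[OF pp NCD(2)[OF p] A(1) X, of a b x1 x2] x1 x2 a b 3 by blast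
      qed
      then have "X \<subseteq> Q \<inter> {a..b} \<or> X \<subseteq> Q - {a..b}" using Y 3 by blast
      then show ?thesis unfolding s_def by blast
    qed
  qed
  then have ps: "refines {1..n} p s" using pp NCD(1)[OF s(1)] by (auto simp: refines_def)
  have I: "Q \<inter> {a..b} \<in> s" "Q - {a..b} \<in> s" "Q \<inter> {a..b} \<noteq> Q - {a..b}"
    using ne unfolding s_def by blast+
  have "NC_less n s q"
    using NC_covered_merge[of s n "Q \<inter> {a..b}" "Q - {a..b}"] s q I
    unfolding NC_covered_def by auto
  then have "p = s" using assms ps p s unfolding NC_covered_def NC_less_def by blast
  then show ?thesis using that[OF I(1,2,3)[folded \<open>p = s\<close>]] s(2) by simp
qed

text \<open>Places the subgraph induced on \<open>Lambda n\<close> between the Hasse diagram and the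
  Cayley graph, for use in \<open>dist_eq_cyc\<close>. Both directions of a cover are Cayley edges
  because a transposition is its own inverse.\<close>

lemma hasse_subset_cayley: "hasse_edges n \<subseteq> cayley_edges n \<inter> Lambda n \<times> Lambda n"
proof -
  have edge: "(sigma p, sigma q) \<in> cayley_edges n \<and> (sigma q, sigma p) \<in> cayley_edges n"
    if c: "NC_covered n p q" for p q
  proof -
    have p: "p \<in> NC n" and q: "q \<in> NC n" using c by (auto simp: NC_covered_def NC_less_def)
    note pp = NCD(1)[OF p] and qq = NCD(1)[OF q]
    obtain A B where AB: "A \<in> p" "B \<in> p" "A \<noteq> B" "q = merge A B p"
      using NC_covered_imp_merge[OF c] .
    obtain a b where ab: "a \<in> A" "b \<in> B" "sigma q = sigma p \<circ> Transposition.transpose a b"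
      using sigma_merge[OF finite_atLeastAtMost pp NCD(2)[OF p] AB(1-3)] AB(4) by metis
    have "a \<noteq> b" using partition_on_blocks(3)[OF pp AB(1-3)] ab by blast
    moreover have "a \<in> {1..n}" "b \<in> {1..n}" using ab AB partition_onD1[OF pp] by blast+
    moreover have "sigma p = sigma q \<circ> Transposition.transpose a b" using ab by (simp add: comp_assoc)
    moreover have "sigma p permutes {1..n}" "sigma q permutes {1..n}"
      using sigma_permutes pp qq by blast+
    ultimately show ?thesis using ab(3) unfolding cayley_edges_def by blast
  qed
  then show ?thesis
    unfolding hasse_edges_def Lambda_def NC_covered_def NC_less_def by blast
qed


subsection \<open>Counting orbits\<close>

text \<open>\<open>orbit f x\<close> collects the iterates from \<open>f x\<close> onwards; for a
  permutation it contains \<open>x\<close> as well. Fixed points give singletons and count as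
  cycles.\<close>

definition orbits :: "'a set \<Rightarrow> ('a \<Rightarrow> 'a) \<Rightarrow> 'a set set" where
  "orbits S f = orbit f ` S"

lemma orbit_eq_of_mem:
  assumes "permutation f" "y \<in> orbit f x" shows "orbit f y = orbit f x"
  using orbit_cyclic_eq3[OF cyclic_on_orbit'[OF assms(1)] assms(2)] .

lemma permutation_transpose_comp: "permutation f \<Longrightarrow> permutation (Transposition.transpose a b \<circ> f)"
  by (intro permutation_compose permutation_swap_id)

lemma orbit_transpose_comp:
  assumes f: "permutation f" and "a \<notin> orbit f x" "b \<notin> orbit f x"
  shows "orbit (Transposition.transpose a b \<circ> f) x = orbit f x"
proof (rule orbit_cong)
  show "x \<in> orbit f x" using f by (rule permutation_self_in_orbit)
  fix s assume "s \<in> orbit f x"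
  then have "f s \<in> orbit f x" by (rule orbit.step)
  then show "(Transposition.transpose a b \<circ> f) s = f s"
    using assms by (auto simp: Transposition.transpose_def)
qed

text \<open>The two maps differ only at points sent to \<open>a\<close> or \<open>b\<close>, so an
  orbit avoiding both is untouched.\<close>

lemma orbits_transpose_comp_subset:
  fixes a b :: 'a
  assumes f: "permutation f"
  defines "g \<equiv> Transposition.transpose a b \<circ> f"
  shows "orbits S f - {orbit f a, orbit f b} \<subseteq> orbits S g"
proof
  fix X assume "X \<in> orbits S f - {orbit f a, orbit f b}"
  then obtain x where x: "x \<in> S" "X = orbit f x" "orbit f x \<noteq> orbit f a" "orbit f x \<noteq> orbit f b"
    by (auto simp: orbits_def)
  then have "a \<notin> orbit f x" "b \<notin> orbit f x" using orbit_eq_of_mem[OF f] by blast+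
  then have "orbit g x = X" unfolding g_def using orbit_transpose_comp[OF f] x by simp
  then show "X \<in> orbits S g" using x by (auto simp: orbits_def)
qed

lemma card_orbits_transpose_comp_le:
  assumes S: "finite S" and f: "permutation f" and ab: "a \<in> S" "b \<in> S"
  shows "card (orbits S (Transposition.transpose a b \<circ> f)) \<le> Suc (card (orbits S f))"
proof -
  define g where "g = Transposition.transpose a b \<circ> f"
  have g: "permutation g" unfolding g_def using f by (rule permutation_transpose_comp)
  have fg: "f = Transposition.transpose a b \<circ> g" by (simp add: g_def fun_eq_iff)
  have fin: "finite (orbits S f)" "finite (orbits S g)" using S by (auto simp: orbits_def)
  \<comment> \<open>Dropping \<open>orbit f a\<close> on the right improves the bound from
    \<open>+ 2\<close> to \<open>+ 1\<close>: an orbit of \<open>g\<close> avoiding \<open>a\<close>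
    differs from it.\<close>
  have sub: "orbits S g - {orbit g a, orbit g b} \<subseteq> orbits S f - {orbit f a}"
  proof
    fix X assume X: "X \<in> orbits S g - {orbit g a, orbit g b}"
    then have 1: "X \<in> orbits S f" using orbits_transpose_comp_subset[OF g, of S a b] fg by auto
    obtain x where x: "X = orbit g x" using X by (auto simp: orbits_def)
    have "a \<notin> X" using X orbit_eq_of_mem[OF g] x by blast
    then have "X \<noteq> orbit f a" using permutation_self_in_orbit[OF f] by blast
    then show "X \<in> orbits S f - {orbit f a}" using 1 by blast
  qed
  have fa: "orbit f a \<in> orbits S f" using ab by (auto simp: orbits_def)
  have "card (orbits S g) \<le> card ((orbits S g - {orbit g a, orbit g b}) \<union> {orbit g a, orbit g b})"
    using fin by (intro card_mono) auto
  also have "\<dots> \<le> card (orbits S g - {orbit g a, orbit g b}) + card {orbit g a, orbit g b}"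
    by (rule card_Un_le)
  also have "card {orbit g a, orbit g b} \<le> 2" by (simp add: card_insert_if)
  also have "card (orbits S g - {orbit g a, orbit g b}) \<le> card (orbits S f - {orbit f a})"
    using fin sub by (intro card_mono) auto
  also have "\<dots> + 2 = Suc (card (orbits S f))"
    using card_Suc_Diff1[OF fin(1) fa] by simp
  finally show ?thesis by (simp add: g_def)
qed

text \<open>The new map fixes \<open>i\<close>, so the cycle of \<open>i\<close> splits into
  \<open>{i}\<close> and the rest. These two orbits and the untouched ones give the lower bound; the
  upper bound is the general one.\<close>

lemma card_orbits_transpose_comp_fix:
  assumes S: "finite S" and f: "permutation f" and i: "i \<in> S" "f i \<in> S" "f i \<noteq> i"
  shows "card (orbits S (Transposition.transpose i (f i) \<circ> f)) = Suc (card (orbits S f))"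
proof (rule antisym)
  define g where "g = Transposition.transpose i (f i) \<circ> f"
  have g: "permutation g" unfolding g_def using f by (rule permutation_transpose_comp)
  have fin: "finite (orbits S f)" "finite (orbits S g)" using S by (auto simp: orbits_def)
  have fi: "orbit f (f i) = orbit f i" using permutation_orbit_step[OF f] .
  have gi: "orbit g i = {i}" unfolding orbit_eq_singleton_iff by (simp add: g_def)
  have s: "orbit g (f i) \<noteq> {i}" using permutation_self_in_orbit[OF g, of "f i"] i by auto
  have n1: "{i} \<notin> orbits S f - {orbit f i}"
    using orbit_eq_of_mem[OF f] by (auto simp: orbits_def)
  have n2: "orbit g (f i) \<notin> orbits S f - {orbit f i}"
    using orbit_eq_of_mem[OF f] permutation_self_in_orbit[OF g, of "f i"] fi
    by (auto simp: orbits_def)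
  have "orbits S f - {orbit f i} \<subseteq> orbits S g"
    using orbits_transpose_comp_subset[OF f, of S i "f i"] fi by (simp add: g_def)
  moreover have "{i} \<in> orbits S g" "orbit g (f i) \<in> orbits S g"
    using i gi unfolding orbits_def by (metis image_eqI)+
  ultimately have sub: "insert {i} (insert (orbit g (f i)) (orbits S f - {orbit f i})) \<subseteq> orbits S g"
    by blast
  have "Suc (card (orbits S f)) = Suc (Suc (card (orbits S f - {orbit f i})))"
    using card_Suc_Diff1[OF fin(1), of "orbit f i"] i(1) by (simp add: orbits_def)
  also have "\<dots> = card (insert {i} (insert (orbit g (f i)) (orbits S f - {orbit f i})))"
    using n1 n2 s fin by simp
  also have "\<dots> \<le> card (orbits S g)"
    using fin sub by (intro card_mono) auto
  finally show "Suc (card (orbits S f)) \<le> card (orbits S (Transposition.transpose i (f i) \<circ> f))"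
    by (simp add: g_def)
  show "card (orbits S (Transposition.transpose i (f i) \<circ> f)) \<le> Suc (card (orbits S f))"
    using card_orbits_transpose_comp_le[OF S f i(1,2)] .
qed

lemma orbits_id: "orbits S id = (\<lambda>x. {x}) ` S"
  unfolding orbits_def by (intro image_cong) (auto simp: orbit_eq_singleton_iff)

lemma card_orbits_id: "card (orbits S id) = card S"
  unfolding orbits_id by (intro card_image) auto

lemma card_orbits_le: "finite S \<Longrightarrow> card (orbits S f) \<le> card S"
  unfolding orbits_def by (rule card_image_le)

section \<open>Cycle count of \<open>inv t \<circ> s\<close> along Cayley paths\<close>

definition cyc :: "nat \<Rightarrow> (nat \<Rightarrow> nat) \<Rightarrow> (nat \<Rightarrow> nat) \<Rightarrow> nat" where
  "cyc n s t = card (orbits {1..n} (inv t \<circ> s))"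

text \<open>A Cayley step multiplies \<open>t\<close> on the right; this becomes a multiplication of
  \<open>inv t \<circ> s\<close> on the left, the side treated by the orbit lemmas.\<close>

lemma inv_comp_transpose:
  assumes "bij t"
  shows "inv (t \<circ> Transposition.transpose a b) = Transposition.transpose a b \<circ> inv t"
  using assms by (subst o_inv_distrib) auto

lemma permutation_inv_comp:
  assumes "s permutes {1..n::nat}" "t permutes {1..n}" shows "permutation (inv t \<circ> s)"
  using assms permutes_compose permutes_inv permutation_permutes by blast

lemma cyc_le: "cyc n s t \<le> n"
  unfolding cyc_def using card_orbits_le[of "{1..n}"] by simp

lemma cyc_self:
  assumes "s permutes {1..n}" shows "cyc n s s = n"
  using permutes_inv_o(2)[OF assms] by (simp add: cyc_def card_orbits_id)

lemma cyc_transpose_le: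
  assumes "s permutes {1..n}" "t permutes {1..n}" "a \<in> {1..n}" "b \<in> {1..n}"
  shows "cyc n s (t \<circ> Transposition.transpose a b) \<le> Suc (cyc n s t)"
  using card_orbits_transpose_comp_le[OF _ permutation_inv_comp[OF assms(1,2)] assms(3,4)]
  unfolding cyc_def inv_comp_transpose[OF permutes_bij[OF assms(2)]] by (simp add: comp_assoc)

lemma cyc_transpose_eq:
  assumes s: "s permutes {1..n}" and t: "t permutes {1..n}" and i: "i \<in> {1..n}" "s i \<noteq> t i"
    and k: "t k = s i"
  shows "cyc n s (t \<circ> Transposition.transpose i k) = Suc (cyc n s t)"
proof -
  have k': "(inv t \<circ> s) i = k" using k t by (metis comp_apply permutes_inverses(2))
  have "s i \<in> {1..n}" using permutes_in_image[OF s] i by blast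
  then have "k \<in> {1..n}" using permutes_in_image[OF t, of k] k by simp
  moreover have "k \<noteq> i" using k i(2) by auto
  ultimately show ?thesis
    using card_orbits_transpose_comp_fix[OF _ permutation_inv_comp[OF s t] i(1)]
    unfolding cyc_def inv_comp_transpose[OF permutes_bij[OF t]] k' by (auto simp: comp_assoc)
qed

text \<open>At \<open>s\<close> itself the count is \<open>n\<close>, and each step lowers it by at
  most one.\<close>

lemma cayley_path_ge:
  assumes "(s, t) \<in> cayley_edges n ^^ m" "s permutes {1..n}"
  shows "t permutes {1..n} \<and> n \<le> cyc n s t + m"
  using assms
proof (induction m arbitrary: t)
  case 0
  then show ?case using cyc_self by simp
next
  case (Suc m)
  then obtain u where u: "(s, u) \<in> cayley_edges n ^^ m" "(u, t) \<in> cayley_edges n" by auto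
  then obtain a b where ab: "t = u \<circ> Transposition.transpose a b" "a \<in> {1..n}" "b \<in> {1..n}"
    unfolding cayley_edges_def by blast
  have IH: "u permutes {1..n}" "n \<le> cyc n s u + m" using Suc u by auto
  have tp: "t permutes {1..n}" unfolding ab(1)
    using permutes_compose[OF permutes_swap_id[OF ab(2,3)] IH(1)] .
  \<comment> \<open>The step is an involution, so bounding the growth from \<open>t\<close> back to
    \<open>u\<close> bounds the loss from \<open>u\<close> to \<open>t\<close>.\<close>
  have "u = t \<circ> Transposition.transpose a b" unfolding ab(1) by (simp add: comp_assoc)
  then have "cyc n s u \<le> Suc (cyc n s t)"
    using cyc_transpose_le[OF Suc.prems(2) tp ab(2,3)] by simp
  then show ?case using IH tp by simp
qed


subsection \<open>Geodesics in the Hasse diagram\<close>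

lemma noncrossing_between:
  assumes "partition_on S q" "noncrossing q" "B \<in> q" "C \<in> q" "B \<noteq> C"
    and "x \<in> B" "y \<in> B" "c \<in> C" "d \<in> C" "x < c" "c < y"
  shows "x < d" "d < y"
proof -
  have "d \<noteq> x" "d \<noteq> y" using block_eq[OF assms(1,3,4)] assms by blast+
  moreover have "\<not> d < x" using noncrossing_blocks_eq[OF assms(1,2,4,3), of d c x y] assms by blast
  moreover have "\<not> y < d" using noncrossing_blocks_eq[OF assms(1-4), of x y c d] assms by blast
  ultimately show "x < d" "d < y" by auto
qed

text \<open>Merging is harmless when \<open>{i<..<j}\<close> is a union of blocks. No other block
  \<open>C\<close> is separated by two points of \<open>I\<close>, by two points of
  \<open>J\<close>, or by \<open>i\<close> and \<open>j\<close>; for a point of \<open>I\<close> and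
  a point of \<open>J\<close> these facts are chained through \<open>i\<close> and
  \<open>j\<close>.\<close>

lemma NC_merge:
  assumes q: "q \<in> NC n" and I: "I \<in> q" "i \<in> I" and J: "J \<in> q" "j \<in> J" and ne: "I \<noteq> J" and ij: "i < j"
    and closed: "\<And>Y x y. \<lbrakk>Y \<in> q; x \<in> Y; i < x; x < j; y \<in> Y\<rbrakk> \<Longrightarrow> i < y \<and> y < j"
  shows "merge I J q \<in> NC n"
proof -
  note qq = NCD(1)[OF q] and nc = NCD(2)[OF q]
  have gap: "\<not> (i < x \<and> x < j)" if "x \<in> I \<union> J" for x
    using that closed[OF I(1), of x i] closed[OF J(1), of x j] I J by blast
  have key: "x < d \<and> d < y"
    if C: "C \<in> q" "C \<noteq> I" "C \<noteq> J" and xy: "x \<in> I \<union> J" "y \<in> I \<union> J" and cd: "c \<in> C" "d \<in> C"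
      and lt: "x < c" "c < y" for C x y c d
  proof -
    have btw: "(u < c \<and> c < v) = (u < d \<and> d < v)" if "B = I \<or> B = J" "u \<in> B" "v \<in> B" for B u v
      using noncrossing_between[OF qq nc _ C(1), of B u v c d] noncrossing_between[OF qq nc _ C(1), of B u v d c]
        that C I J cd by blast
    have neq: "u \<noteq> c" "u \<noteq> d" if "u \<in> I \<union> J" for u
      using that block_eq[OF qq C(1) I(1)] block_eq[OF qq C(1) J(1)] C cd by blast+
    have C_gap: "(i < c \<and> c < j) = (i < d \<and> d < j)"
      using closed[OF C(1) cd(1) _ _ cd(2)] closed[OF C(1) cd(2) _ _ cd(1)] by blast
    have mixed: "x < d \<and> d < y" if "x \<in> I \<and> y \<in> J \<or> x \<in> J \<and> y \<in> I"
      using that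
    proof
      assume *: "x \<in> I \<and> y \<in> J"
      then have "(x < c \<and> c < i) = (x < d \<and> d < i)" "(i < c \<and> c < x) = (i < d \<and> d < x)"
        "(y < c \<and> c < j) = (y < d \<and> d < j)" "(j < c \<and> c < y) = (j < d \<and> d < y)"
        using btw[of I x i] btw[of I i x] btw[of J y j] btw[of J j y] I J by blast+
      moreover have "x \<noteq> d" "y \<noteq> d" "i \<noteq> c" "i \<noteq> d" "j \<noteq> c" "j \<noteq> d" "\<not> (i < x \<and> x < j)" "\<not> (i < y \<and> y < j)"
        using neq gap xy I J by blast+
      ultimately show ?thesis using C_gap lt ij by (metis nat_neq_iff order_less_trans)
    next
      assume *: "x \<in> J \<and> y \<in> I"
      then have "(x < c \<and> c < j) = (x < d \<and> d < j)" "(j < c \<and> c < x) = (j < d \<and> d < x)"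
        "(y < c \<and> c < i) = (y < d \<and> d < i)" "(i < c \<and> c < y) = (i < d \<and> d < y)"
        using btw[of J x j] btw[of J j x] btw[of I y i] btw[of I i y] I J by blast+
      moreover have "x \<noteq> d" "y \<noteq> d" "i \<noteq> c" "i \<noteq> d" "j \<noteq> c" "j \<noteq> d" "\<not> (i < x \<and> x < j)" "\<not> (i < y \<and> y < j)"
        using neq gap xy I J by blast+
      ultimately show ?thesis using C_gap lt ij by (metis nat_neq_iff order_less_trans)
    qed
    show ?thesis
      using mixed btw[of I x y] btw[of J x y] xy lt by blast
  qed
  have "noncrossing (merge I J q)"
  proof (rule noncrossingI)
    fix B C x j k l
    assume *: "B \<in> merge I J q" "C \<in> merge I J q" "B \<noteq> C" "x \<in> B" "k \<in> B" "j \<in> C" "l \<in> C"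
      "x < j" "j < k" "k < (l::nat)"
    consider "B \<in> q" "C \<in> q" | "B = I \<union> J" "C \<in> q" "C \<noteq> I" "C \<noteq> J" | "C = I \<union> J" "B \<in> q" "B \<noteq> I" "B \<noteq> J"
      using *(1,2,3) unfolding merge_def by blast
    then show False
    proof cases
      case 1
      then show ?thesis using noncrossing_blocks_eq[OF qq nc 1, of x k j l] * by blast
    next
      case 2
      then show ?thesis using key[OF 2(2-4), of x k j l] * by auto
    next
      case 3
      then show ?thesis using key[OF 3(2-4), of j l k x] * by auto
    qed
  qed
  then show ?thesis using partition_on_merge[OF qq I(1) J(1)] by (simp add: NC_def)
qed

text \<open>A transposition that changes the value at \<open>i\<close> must move \<open>i\<close>,
  and its other entry is then the preimage of \<open>s i\<close> under \<open>t\<close>. The value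
  at \<open>i\<close> alone thus identifies the transposition.\<close>

lemma cyc_transpose_eqI:
  assumes s: "s permutes {1..n}" and t: "t permutes {1..n}" and i: "i \<in> {1..n}" "s i \<noteq> t i"
    and ti: "(t \<circ> Transposition.transpose a b) i = s i"
  shows "cyc n s (t \<circ> Transposition.transpose a b) = Suc (cyc n s t)"
proof -
  have "i = a \<or> i = b" using ti i(2) by (auto simp: Transposition.transpose_def split: if_splits)
  then show ?thesis
    using cyc_transpose_eq[OF s t i, of a] cyc_transpose_eq[OF s t i, of b] ti
    by (auto simp: transpose_commute)
qed

text \<open>A missing arc going right (\<open>i < j\<close>) calls for merging the blocks of
  \<open>i\<close> and \<open>j\<close> in \<open>q\<close>. A missing arc going left
  (\<open>j \<le> i\<close>) closes a block with extremes \<open>j\<close> and \<open>i\<close>; in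
  \<open>q\<close> these already share a block, out of which the interval is cut.\<close>

lemma hasse_step:
  assumes p: "p \<in> NC n" and q: "q \<in> NC n" and ne: "sigma p \<noteq> sigma q"
  obtains q' where "q' \<in> NC n" "NC_covered n q q' \<or> NC_covered n q' q"
    "cyc n (sigma p) (sigma q') = Suc (cyc n (sigma p) (sigma q))"
proof -
  note result = that
  define s where "s = sigma p"
  define t where "t = sigma q"
  note pp = NCD(1)[OF p] and qq = NCD(1)[OF q] and fin = finite_atLeastAtMost[of 1 n]
  have s: "s permutes {1..n}" and t: "t permutes {1..n}"
    using sigma_permutes pp qq by (auto simp: s_def t_def)
  \<comment> \<open>Distance between the coordinates \<open>2 * x + 1\<close> of \<open>R x\<close>
    and \<open>2 * s x\<close> of \<open>L (s x)\<close>; the case split keeps the natural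
    subtraction from truncating.\<close>
  define len where "len x = (if x < s x then 2 * s x - (2 * x + 1) else 2 * x + 1 - 2 * s x)" for x
  obtain i0 where "s i0 \<noteq> t i0" using ne by (auto simp: s_def t_def)
  then obtain i where i: "s i \<noteq> t i" and least: "\<And>x. s x \<noteq> t x \<Longrightarrow> len i \<le> len x"
    using ex_has_least_nat[of "\<lambda>x. s x \<noteq> t x" i0 len] by blast
  have agree: "s x = t x" if "len x < len i" for x
    using least[of x] that by linarith
  have iS: "i \<in> {1..n}"
    using i permutes_not_in[OF s] permutes_not_in[OF t] by metis
  define j where "j = s i"
  have jS: "j \<in> {1..n}" unfolding j_def using permutes_in_image[OF s] iS by blast
  obtain P where P: "P \<in> p" "i \<in> P" using block_of[OF pp iS] .
  have nxtP: "is_nxt P i j" unfolding j_def s_def using is_nxt_sigma[OF pp fin P] .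
  have sX: "s x \<in> X" if "X \<in> p" "x \<in> X" for X x
    unfolding s_def using sigma_in_block[OF pp fin that] .
  have nxtq: "is_nxt Y x (t x)" if "Y \<in> q" "x \<in> Y" for Y x
    unfolding t_def using is_nxt_sigma[OF qq fin that] .
  have finish: ?thesis
    if q': "q' \<in> NC n" "NC_covered n q q' \<or> NC_covered n q' q"
      and ab: "sigma q' = t \<circ> Transposition.transpose a b" and q'i: "sigma q' i = j" for q' a b
    using result[OF q'] cyc_transpose_eqI[OF s t iS i, of a b] ab q'i by (simp add: s_def t_def j_def)
  show ?thesis
  proof (cases "i < j")
    case True
    \<comment> \<open>Consecutive points \<open>i\<close>, \<open>j\<close> of \<open>P\<close>
      isolate the points between them from the rest of \<open>p\<close>.\<close>
    have p_in: "i < y \<and> y < j" if X: "X \<in> p" "x \<in> X" "i < x" "x < j" "y \<in> X" for X x y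
    proof -
      have "X \<noteq> P" using is_nxtD(3)[OF nxtP, of x] X True by auto
      then show ?thesis
        using noncrossing_between[OF pp NCD(2)[OF p] P(1) X(1) _ P(2) is_nxtD(2)[OF nxtP] X(2,5) X(3,4)] by auto
    qed
    have t_in: "i < t x \<and> t x < j" if x: "i < x" "x < j" for x
    proof -
      have "x \<in> {1..n}" using x iS jS by auto
      then obtain X where X: "X \<in> p" "x \<in> X" using block_of[OF pp] by blast
      have sx: "i < s x \<and> s x < j" using p_in[OF X x sX[OF X]] .
      then have "len x < len i" using x True unfolding len_def j_def by auto
      then show ?thesis using agree sx by simp
    qed
    \<comment> \<open>For the largest point \<open>z\<close> of \<open>Y\<close> in the gap,
      \<open>t z\<close> is again in the gap and not beyond \<open>z\<close>. So the cycle wraps at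
      \<open>z\<close>, and \<open>t z\<close> and \<open>z\<close> are the extremes of
      \<open>Y\<close>.\<close>
    have closed: "i < y \<and> y < j" if Y: "Y \<in> q" "x \<in> Y" "i < x" "x < j" "y \<in> Y" for Y x y
    proof -
      define z where "z = Max (Y \<inter> {i<..<j})"
      have ne: "Y \<inter> {i<..<j} \<noteq> {}" using Y by auto
      have "z \<in> Y \<inter> {i<..<j}" unfolding z_def using ne by (intro Max_in) auto
      then have z: "z \<in> Y" "i < z" "z < j" by auto
      have zmax: "w \<le> z" if "w \<in> Y" "i < w" "w < j" for w
        unfolding z_def using that by (intro Max_ge) auto
      note nz = nxtq[OF Y(1) z(1)]
      have "t z \<le> z" using zmax[OF is_nxtD(2)[OF nz]] t_in[OF z(2,3)] by simp
      then show ?thesis using is_nxtD(3)[OF nz Y(5)] t_in[OF z(2,3)] z by linarith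
    qed
    obtain I where I: "I \<in> q" "i \<in> I" using block_of[OF qq iS] .
    obtain J where J: "J \<in> q" "j \<in> J" using block_of[OF qq jS] .
    \<comment> \<open>Within one block, \<open>j\<close> would already be the successor of
      \<open>i\<close>.\<close>
    have "I \<noteq> J"
    proof
      assume "I = J"
      moreover have "\<not> (i < z \<and> z < j)" if "z \<in> I" for z using closed[OF I(1) that _ _ I(2)] by blast
      ultimately have "is_nxt I i j" using I J True unfolding is_nxt_def by blast
      then have "t i = j" using is_nxt_unique nxtq[OF I] by blast
      then show False using i j_def by simp
    qed
    have q': "merge I J q \<in> NC n" by (rule NC_merge[OF q I J \<open>I \<noteq> J\<close> True]) (rule closed)
    obtain a b where ab: "sigma (merge I J q) = t \<circ> Transposition.transpose a b"
      using sigma_merge[OF fin qq NCD(2)[OF q] I(1) J(1) \<open>I \<noteq> J\<close>] unfolding t_def by metis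
    have "\<not> (i < z \<and> z < j)" if "z \<in> I \<union> J" for z
      using that closed[OF I(1) _ _ _ I(2)] closed[OF J(1) _ _ _ J(2)] by blast
    then have "is_nxt (I \<union> J) i j" using I J True unfolding is_nxt_def by blast
    then have "sigma (merge I J q) i = j"
      using sigma_eqI[OF NCD(1)[OF q'] fin, of "I \<union> J"] by (simp add: merge_def)
    then show ?thesis
      using finish[OF q' _ ab] NC_covered_merge[OF q q' I(1) J(1) \<open>I \<noteq> J\<close>] by blast
  next
    case False
    have P_in: "j \<le> y \<and> y \<le> i" if "y \<in> P" for y using is_nxtD(3)[OF nxtP that] False by linarith
    \<comment> \<open>The arc encloses \<open>R x\<close> for \<open>j \<le> x < i\<close> and
      \<open>L y\<close> for \<open>j < y \<le> i\<close>, whence the half-open ranges.\<close>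
    have t_in: "j < t x \<and> t x \<le> i" if x: "j \<le> x" "x < i" for x
    proof -
      have "x \<in> {1..n}" using x iS jS by auto
      then obtain X where X: "X \<in> p" "x \<in> X" using block_of[OF pp] by blast
      have "j \<le> s x \<and> s x \<le> i"
      proof (cases "X = P")
        case True
        then show ?thesis using P_in sX[OF X] by blast
      next
        case False
        then have "j \<noteq> x" using block_eq[OF pp X(1) P(1)] X is_nxtD(2)[OF nxtP] by blast
        then show ?thesis
          using noncrossing_between[OF pp NCD(2)[OF p] P(1) X(1) _ is_nxtD(2)[OF nxtP] P(2) X(2) sX[OF X]] x False
          by simp
      qed
      moreover have "s x \<noteq> j" unfolding j_def using x permutes_inj[OF s] by (auto dest: injD)
      ultimately have sx: "j < s x \<and> s x \<le> i" by simp
      then have "len x < len i" using x False unfolding len_def j_def[symmetric] by auto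
      then show ?thesis using agree sx by simp
    qed
    obtain Q where Q: "Q \<in> q" "j \<in> Q" using block_of[OF qq jS] .
    \<comment> \<open>If the largest point \<open>z\<close> of \<open>Q\<close> in the interval were
      below \<open>i\<close>, the cycle would wrap at \<open>z\<close> to a minimum
      \<open>t z > j\<close>, although \<open>j\<close> belongs to \<open>Q\<close>.\<close>
    have iQ: "i \<in> Q"
    proof -
      define z where "z = Max (Q \<inter> {j..i})"
      have ne: "Q \<inter> {j..i} \<noteq> {}" using Q False by auto
      have "z \<in> Q \<inter> {j..i}" unfolding z_def using ne by (intro Max_in) auto
      then have z: "z \<in> Q" "j \<le> z" "z \<le> i" by auto
      have zmax: "w \<le> z" if "w \<in> Q" "j \<le> w" "w \<le> i" for w
        unfolding z_def using that by (intro Max_ge) auto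
      note nz = nxtq[OF Q(1) z(1)]
      have "\<not> z < i"
      proof
        assume zi: "z < i"
        have "t z \<le> z" using zmax[OF is_nxtD(2)[OF nz]] t_in[OF z(2) zi] by simp
        then show False using is_nxtD(3)[OF nz Q(2)] t_in[OF z(2) zi] by linarith
      qed
      then show ?thesis using z by simp
    qed
    have ne1: "Q \<inter> {j..i} \<noteq> {}" using Q False by auto
    have ne2: "Q - {j..i} \<noteq> {}"
    proof
      assume "Q - {j..i} = {}"
      then have "j \<le> z \<and> z \<le> i" if "z \<in> Q" for z using that by auto
      then have "is_nxt Q i j" using Q iQ False unfolding is_nxt_def by auto
      then have "t i = j" using is_nxt_unique nxtq[OF Q(1) iQ] by blast
      then show False using i j_def by simp
    qed
    define r where "r = insert (Q \<inter> {j..i}) (insert (Q - {j..i}) (q - {Q}))"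
    note cut = NC_cut[OF q Q(1) ne1 ne2 r_def]
    have M: "Q \<inter> {j..i} \<in> r" "Q - {j..i} \<in> r" "Q \<inter> {j..i} \<noteq> Q - {j..i}"
      using ne1 unfolding r_def by auto
    \<comment> \<open>\<open>q\<close> is the merge of the two parts, and the same transposition
      undoes the merge.\<close>
    obtain a b where "t = sigma r \<circ> Transposition.transpose a b"
      using sigma_merge[OF fin NCD[OF cut(1)] M] unfolding t_def cut(2) by metis
    then have ab: "sigma r = t \<circ> Transposition.transpose a b" by (simp add: comp_assoc)
    have "is_nxt (Q \<inter> {j..i}) i j" using Q iQ False unfolding is_nxt_def by auto
    then have "sigma r i = j" using sigma_eqI[OF NCD(1)[OF cut(1)] fin M(1)] by blast
    then show ?thesis
      using finish[OF cut(1) _ ab] NC_covered_merge[OF cut(1) _ M] cut(2) q by simp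
  qed
qed

lemma hasse_path:
  assumes "p \<in> NC n" "q \<in> NC n"
  shows "(sigma p, sigma q) \<in> hasse_edges n ^^ (n - cyc n (sigma p) (sigma q))"
  using assms(2)
proof (induction "n - cyc n (sigma p) (sigma q)" arbitrary: q rule: less_induct)
  case (less q)
  have sp: "sigma p permutes {1..n}" using sigma_permutes[OF NCD(1)[OF assms(1)]] by simp
  show ?case
  proof (cases "sigma p = sigma q")
    case True
    then show ?thesis using cyc_self[OF sp] by simp
  next
    case False
    obtain q' where q': "q' \<in> NC n" "NC_covered n q q' \<or> NC_covered n q' q"
      "cyc n (sigma p) (sigma q') = Suc (cyc n (sigma p) (sigma q))"
      using hasse_step[OF assms(1) less.prems False] .
    \<comment> \<open>Keeps the truncated difference positive, so that it drops by exactly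
      one.\<close>
    have "Suc (cyc n (sigma p) (sigma q)) \<le> n" using cyc_le[of n "sigma p" "sigma q'"] q'(3) by simp
    then have n: "n - cyc n (sigma p) (sigma q) = Suc (n - cyc n (sigma p) (sigma q'))" using q'(3) by simp
    have "(sigma p, sigma q') \<in> hasse_edges n ^^ (n - cyc n (sigma p) (sigma q'))"
      using less.hyps[OF _ q'(1)] n by simp
    moreover have "(sigma q', sigma q) \<in> hasse_edges n" using q'(2) unfolding hasse_edges_def by blast
    ultimately show ?thesis unfolding n by auto
  qed
qed

section \<open>Distances squeezed between the Hasse diagram and the Cayley graph\<close>

lemma graph_dist_eqI:
  assumes "(x, y) \<in> E ^^ m" "\<And>k. (x, y) \<in> E ^^ k \<Longrightarrow> m \<le> k"
  shows "graph_dist E x y = m"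
  unfolding graph_dist_def using assms by (rule Least_equality)

lemma relpow_subset_mono: "(E :: ('a \<times> 'a) set) \<subseteq> F \<Longrightarrow> E ^^ m \<subseteq> F ^^ m"
  by (induction m) auto

text \<open>The Hasse path survives in any larger edge set and the lower bound in any smaller one,
  so one statement serves the Hasse diagram, the induced subgraph and the Cayley graph.\<close>

lemma dist_eq_cyc:
  assumes "\<sigma> \<in> Lambda n" "\<tau> \<in> Lambda n"
    and E: "hasse_edges n \<subseteq> E" "E \<subseteq> cayley_edges n"
  shows "graph_dist E \<sigma> \<tau> = n - cyc n \<sigma> \<tau>"
proof (rule graph_dist_eqI)
  show "(\<sigma>, \<tau>) \<in> E ^^ (n - cyc n \<sigma> \<tau>)"
    using assms hasse_path relpow_subset_mono[OF E(1)] unfolding Lambda_def by blast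
  have "\<sigma> permutes {1..n}" using assms(1) NCD(1) sigma_permutes unfolding Lambda_def by blast
  then show "n - cyc n \<sigma> \<tau> \<le> k" if "(\<sigma>, \<tau>) \<in> E ^^ k" for k
    using cayley_path_ge[of \<sigma> \<tau> k n] relpow_subset_mono[OF E(2)] that by force
qed


subsection \<open>Drawing the arcs as semicircles\<close>

text \<open>The half circle over the diameter from \<open>a\<close> to \<open>b\<close>, with real
  part linear in the parameter. Injectivity is then immediate, and the squared height is the product
  of the horizontal distances to both ends.\<close>

definition semicircle :: "real \<Rightarrow> real \<Rightarrow> real \<Rightarrow> complex" where
  "semicircle a b t = Complex ((1 - t) * a + t * b) (\<bar>b - a\<bar> * sqrt (t * (1 - t)))"

lemma semicircle_ends:
  "pathstart (semicircle a b) = complex_of_real a" "pathfinish (semicircle a b) = complex_of_real b"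
  by (simp_all add: semicircle_def pathstart_def pathfinish_def complex_of_real_def)

lemma arc_semicircle:
  assumes "a \<noteq> b" shows "arc (semicircle a b)"
  unfolding arc_def
proof
  show "path (semicircle a b)"
    unfolding path_def semicircle_def Complex_eq by (intro continuous_intros)
  show "inj_on (semicircle a b) {0..1}"
  proof (rule inj_onI)
    fix s t assume "semicircle a b s = semicircle a b t"
    then have "(1 - s) * a + s * b = (1 - t) * a + t * b" by (simp add: semicircle_def)
    then have "(s - t) * (b - a) = 0" by algebra
    then show "s = t" using assms by simp
  qed
qed

lemma semicircle_image:
  assumes "z \<in> path_image (semicircle a b)"
  shows "min a b \<le> Re z" "Re z \<le> max a b"
    "(Im z)\<^sup>2 = (Re z - min a b) * (max a b - Re z)"
proof -
  obtain t where t: "0 \<le> t" "t \<le> 1" "z = semicircle a b t"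
    using assms by (auto simp: path_image_def)
  have re: "Re z = (1 - t) * a + t * b" and im: "Im z = \<bar>b - a\<bar> * sqrt (t * (1 - t))"
    using t by (auto simp: semicircle_def)
  have "Re z - a = t * (b - a)" "b - Re z = (1 - t) * (b - a)"
    unfolding re by (simp_all add: algebra_simps)
  moreover have "0 \<le> t * (1 - t)" using t by simp
  ultimately have "(Im z)\<^sup>2 = (Re z - a) * (b - Re z)"
    unfolding im power_mult_distrib power2_abs by (simp add: power2_eq_square)
  then show "(Im z)\<^sup>2 = (Re z - min a b) * (max a b - Re z)"
    by (simp add: min_def max_def algebra_simps)
  show "min a b \<le> Re z" "Re z \<le> max a b"
    using convex_bound_le[of a "max a b" b "1 - t" t] convex_bound_le[of "- a" "- min a b" "- b" "1 - t" t] t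
    unfolding re by auto
qed

lemma semicircle_interior:
  assumes "a \<noteq> b"
  shows "path_image (semicircle a b) - {pathstart (semicircle a b), pathfinish (semicircle a b)} \<subseteq> {z. Im z > 0}"
proof
  fix z assume z: "z \<in> path_image (semicircle a b) - {pathstart (semicircle a b), pathfinish (semicircle a b)}"
  then obtain t where t: "0 \<le> t" "t \<le> 1" "z = semicircle a b t" by (auto simp: path_image_def)
  have "t \<noteq> 0" "t \<noteq> 1" using z t by (auto simp: pathstart_def pathfinish_def)
  then have "0 < t" "t < 1" using t by auto
  then show "z \<in> {z. Im z > 0}" using t assms by (simp add: semicircle_def)
qed

text \<open>The order pattern of two non-crossing arcs: spans disjoint or strictly nested, whichever
  way each arc is oriented.\<close>

definition separated :: "'a::linorder \<Rightarrow> 'a \<Rightarrow> 'a \<Rightarrow> 'a \<Rightarrow> bool" where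
  "separated a b c d \<longleftrightarrow> max a b < min c d \<or> max c d < min a b \<or>
     (min a b < min c d \<and> max c d < max a b) \<or> (min c d < min a b \<and> max a b < max c d)"

lemma semicircle_disjoint:
  assumes "separated a b c d"
  shows "path_image (semicircle a b) \<inter> path_image (semicircle c d) = {}"
proof -
  have "False" if z: "z \<in> path_image (semicircle a b)" "z \<in> path_image (semicircle c d)" for z
  proof -
    note ab = semicircle_image[OF z(1)] and cd = semicircle_image[OF z(2)]
    \<comment> \<open>Above the same real part, the circle with the smaller span runs strictly
      lower.\<close>
    have nested: "(r - m') * (M' - r) < (r - m) * (M - r)"
      if "m < m'" "m' \<le> r" "r \<le> M'" "M' < M" for m m' M M' r :: real
      using that by (intro mult_strict_mono') auto
    show False
      using assms ab cd nested[of "min a b" "min c d" "Re z" "max c d" "max a b"]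
        nested[of "min c d" "min a b" "Re z" "max a b" "max c d"]
      unfolding separated_def by linarith
  qed
  then show ?thesis by blast
qed

text \<open>Only the order of the end points matters, which moves the check from integer coordinates
  to arbitrary real positions.\<close>

lemma separated_strict_mono:
  fixes f :: "nat \<Rightarrow> real"
  assumes f: "\<And>x y. x \<in> S \<Longrightarrow> y \<in> S \<Longrightarrow> x < y \<Longrightarrow> f x < f y"
    and S: "a \<in> S" "b \<in> S" "c \<in> S" "d \<in> S" and sep: "separated a b c d"
  shows "separated (f a) (f b) (f c) (f d)"
proof -
  have le: "f x \<le> f y" if "x \<in> S" "y \<in> S" "x \<le> y" for x y
    using f[of x y] that by (cases "x = y") auto
  have mm: "f (min x y) = min (f x) (f y)" "f (max x y) = max (f x) (f y)" "min x y \<in> S" "max x y \<in> S"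
    if "x \<in> S" "y \<in> S" for x y
    using le[of x y] le[of y x] that by (auto simp: min_def max_def)
  show ?thesis
    using sep mm[OF S(1,2)] mm[OF S(3,4)] f unfolding separated_def
    by metis
qed

text \<open>The points \<open>L i\<close> and \<open>R i\<close> receive the integer coordinates \<open>2 * i\<close> and \<open>2 * i + 1\<close>.\<close>

lemma sigma_arcs_separated:
  assumes p: "p \<in> NC n" and S: "i \<in> {1..n}" "j \<in> {1..n}" and ij: "i \<noteq> j"
  shows "separated (2 * i + 1) (2 * sigma p i) (2 * j + 1) (2 * sigma p j)"
proof -
  note pp = NCD(1)[OF p] and nc = NCD(2)[OF p]
  define s where "s = sigma p"
  have inj: "s i \<noteq> s j" using permutes_inj[OF sigma_permutes[OF pp]] ij by (auto simp: s_def dest: injD)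
  obtain P where P: "P \<in> p" "i \<in> P" using block_of[OF pp S(1)] .
  obtain Q where Q: "Q \<in> p" "j \<in> Q" using block_of[OF pp S(2)] .
  have nP: "is_nxt P i (s i)" and nQ: "is_nxt Q j (s j)"
    using is_nxt_sigma[OF pp _ P] is_nxt_sigma[OF pp _ Q] by (auto simp: s_def)
  note PQ = P(2) Q(2) is_nxtD(2)[OF nP] is_nxtD(2)[OF nQ]
  have "separated (2 * i + 1) (2 * s i) (2 * j + 1) (2 * s j)"
  proof (cases "P = Q")
    \<comment> \<open>Arcs of one block lie side by side, except for the wrapping arc, which
      encloses the others.\<close>
    case True
    then show ?thesis
      using is_nxtD(3)[OF nP, of j] is_nxtD(3)[OF nP, of "s j"] is_nxtD(3)[OF nQ, of i]
        is_nxtD(3)[OF nQ, of "s i"] PQ inj ij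
      unfolding separated_def min_def max_def by (simp split: if_splits) linarith
  next
    case False
    define a b c d where abcd_defs: "a = min i (s i)" "b = max i (s i)" "c = min j (s j)" "d = max j (s j)"
    have abcd: "a \<in> P" "b \<in> P" "c \<in> Q" "d \<in> Q" "a \<le> b" "c \<le> d"
      using PQ by (auto simp: abcd_defs min_def max_def)
    have "\<not> (a < c \<and> c < b \<and> b < d)" "\<not> (c < a \<and> a < d \<and> d < b)"
      using noncrossing_blocks_eq[OF pp nc P(1) Q(1) abcd(1-4)]
        noncrossing_blocks_eq[OF pp nc Q(1) P(1) abcd(3,4,1,2)] False by blast+
    moreover have "a \<noteq> c" "a \<noteq> d" "b \<noteq> c" "b \<noteq> d"
      using block_eq[OF pp P(1) Q(1)] abcd False by blast+
    ultimately have "b < c \<or> d < a \<or> a < c \<and> d < b \<or> c < a \<and> b < d"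
      using abcd(5,6) by linarith
    \<comment> \<open>Each coordinate exceeds twice its index by at most one, so strict inequalities
      between indices carry over.\<close>
    moreover have "2 * a \<le> min (2 * i + 1) (2 * s i)" "min (2 * i + 1) (2 * s i) \<le> 2 * a + 1"
      "2 * b \<le> max (2 * i + 1) (2 * s i)" "max (2 * i + 1) (2 * s i) \<le> 2 * b + 1"
      "2 * c \<le> min (2 * j + 1) (2 * s j)" "min (2 * j + 1) (2 * s j) \<le> 2 * c + 1"
      "2 * d \<le> max (2 * j + 1) (2 * s j)" "max (2 * j + 1) (2 * s j) \<le> 2 * d + 1"
      unfolding abcd_defs by auto
    ultimately show ?thesis unfolding separated_def by linarith
  qed
  then show ?thesis by (simp add: s_def)
qed

lemma meander_points_mono:
  assumes "meander_points n L R"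
  defines "pos \<equiv> \<lambda>m. if even m then L (m div 2) else R (m div 2)"
  assumes "x \<in> {2..2 * n + 1}" "y \<in> {2..2 * n + 1}" "x < y"
  shows "pos x < pos y"
proof -
  have step: "pos m < pos (Suc m)" if m: "2 \<le> m" "m < 2 * n + 1" for m
  proof (cases "even m")
    case True
    then obtain k where "m = 2 * k" by blast
    then show ?thesis using assms(1) m by (auto simp: meander_points_def pos_def)
  next
    case False
    then obtain k where "m = 2 * k + 1" using oddE by blast
    then show ?thesis using assms(1) m by (auto simp: meander_points_def pos_def)
  qed
  have "2 \<le> x \<Longrightarrow> y \<le> 2 * n + 1 \<Longrightarrow> pos x < pos y" using \<open>x < y\<close>
  proof (induction y rule: less_Suc_induct)
    case (1 m)
    then show ?case using step[of m] by simp
  next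
    case (2 a b c)
    then show ?case by force
  qed
  then show ?thesis using assms by simp
qed

lemma meander_points_distinct:
  assumes "meander_points n L R" "x \<in> {1..n}" "y \<in> {1..n}"
  shows "L x = L y \<longleftrightarrow> x = y" "R x = R y \<longleftrightarrow> x = y" "L x \<noteq> R y"
proof -
  note mono = meander_points_mono[OF assms(1)]
  show "L x = L y \<longleftrightarrow> x = y"
    using mono[of "2 * x" "2 * y"] mono[of "2 * y" "2 * x"] assms by (cases x y rule: linorder_cases) auto
  show "R x = R y \<longleftrightarrow> x = y"
    using mono[of "2 * x + 1" "2 * y + 1"] mono[of "2 * y + 1" "2 * x + 1"] assms
    by (cases x y rule: linorder_cases) auto
  show "L x \<noteq> R y"
    using mono[of "2 * x" "2 * y + 1"] mono[of "2 * y + 1" "2 * x"] assms by (cases "x \<le> y") auto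
qed

section \<open>Existence of a drawing\<close>

lemma upper_arc_family:
  assumes \<sigma>: "\<sigma> \<in> Lambda n" and mp: "meander_points n L R"
  shows "arc_family n L R {z. Im z > 0} \<sigma> (\<lambda>i. semicircle (R i) (L (\<sigma> i)))"
proof -
  obtain p where p: "p \<in> NC n" "\<sigma> = sigma p" using \<sigma> by (auto simp: Lambda_def)
  have perm: "\<sigma> permutes {1..n}" using sigma_permutes[OF NCD(1)[OF p(1)]] p by simp
  then have \<sigma>S: "\<sigma> i \<in> {1..n}" if "i \<in> {1..n}" for i using permutes_in_image that by metis
  have ne: "R i \<noteq> L (\<sigma> i)" if "i \<in> {1..n}" for i
    using meander_points_distinct(3)[OF mp \<sigma>S[OF that] that] by simp
  have dis: "path_image (semicircle (R i) (L (\<sigma> i))) \<inter> path_image (semicircle (R j) (L (\<sigma> j))) = {}"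
    if ij: "i \<in> {1..n}" "j \<in> {1..n}" "i \<noteq> j" for i j
  proof (rule semicircle_disjoint)
    define pos where "pos m = (if even m then L (m div 2) else R (m div 2))" for m
    have "separated (pos (2 * i + 1)) (pos (2 * \<sigma> i)) (pos (2 * j + 1)) (pos (2 * \<sigma> j))"
    proof (rule separated_strict_mono[of "{2..2 * n + 1}"])
      show "pos x < pos y" if "x \<in> {2..2 * n + 1}" "y \<in> {2..2 * n + 1}" "x < y" for x y
        unfolding pos_def using meander_points_mono[OF mp that] .
      show "separated (2 * i + 1) (2 * \<sigma> i) (2 * j + 1) (2 * \<sigma> j)"
        unfolding p(2) using sigma_arcs_separated[OF p(1) ij] .
    qed (use ij \<sigma>S[OF ij(1)] \<sigma>S[OF ij(2)] in auto)
    then show "separated (R i) (L (\<sigma> i)) (R j) (L (\<sigma> j))" by (simp add: pos_def)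
  qed
  show ?thesis
    unfolding arc_family_def disjoint_family_on_def
    using arc_semicircle[OF ne] semicircle_ends semicircle_interior[OF ne] dis by blast
qed

lemma lower_arc_family:
  assumes "arc_family n L R {z. Im z > 0} \<sigma> g"
  shows "arc_family n L R {z. Im z < 0} \<sigma> (\<lambda>i. cnj \<circ> g i)"
proof -
  have "arc (cnj \<circ> g i)" if g: "arc (g i)" for i
    unfolding arc_def
  proof
    show "path (cnj \<circ> g i)" using g by (intro path_continuous_image continuous_intros) (simp add: arc_def)
    show "inj_on (cnj \<circ> g i) {0..1}"
      using g by (intro comp_inj_on) (auto simp: arc_def intro: inj_onI)
  qed
  note arc = this
  note im = path_image_compose[of cnj]
  show ?thesis
    unfolding arc_family_def disjoint_family_on_def
  proof (intro conjI ballI impI)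
    fix i assume i: "i \<in> {1..n}"
    have g: "arc (g i)" "pathstart (g i) = complex_of_real (R i)" "pathfinish (g i) = complex_of_real (L (\<sigma> i))"
      "path_image (g i) - {pathstart (g i), pathfinish (g i)} \<subseteq> {z. Im z > 0}"
      using assms i unfolding arc_family_def by blast+
    show "arc (cnj \<circ> g i)" using arc g(1) .
    show start: "pathstart (cnj \<circ> g i) = complex_of_real (R i)"
      and finish: "pathfinish (cnj \<circ> g i) = complex_of_real (L (\<sigma> i))"
      using g(2,3) by (simp_all add: pathstart_compose pathfinish_compose)
    show "path_image (cnj \<circ> g i) - {pathstart (cnj \<circ> g i), pathfinish (cnj \<circ> g i)} \<subseteq> {z. Im z < 0}"
    proof
      fix z assume z: "z \<in> path_image (cnj \<circ> g i) - {pathstart (cnj \<circ> g i), pathfinish (cnj \<circ> g i)}"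
      then obtain w where w: "w \<in> path_image (g i)" "z = cnj w" unfolding im by blast
      then have "w \<noteq> pathstart (g i)" "w \<noteq> pathfinish (g i)" using z start finish g(2,3) by auto
      then have "Im w > 0" using g(4) w by blast
      then show "z \<in> {z. Im z < 0}" using w by simp
    qed
  next
    fix i j assume "i \<in> {1..n}" "j \<in> {1..n}" "i \<noteq> j"
    then have "path_image (g i) \<inter> path_image (g j) = {}"
      using assms unfolding arc_family_def disjoint_family_on_def by blast
    then show "path_image (cnj \<circ> g i) \<inter> path_image (cnj \<circ> g j) = {}"
      unfolding im by auto
  qed
qed

lemma meander_drawing_exists:
  assumes "\<sigma> \<in> Lambda n" "\<tau> \<in> Lambda n" "meander_points n L R"
  shows "\<exists>u l. meander_drawing n L R \<sigma> \<tau> u l"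
  unfolding meander_drawing_def
  using upper_arc_family[OF assms(1,3)] lower_arc_family[OF upper_arc_family[OF assms(2,3)]] by blast


subsection \<open>The loops of a drawing\<close>

text \<open>Finiteness makes the union \<open>D\<close> of the remaining sets closed, so a connected
  subset of the whole that meets \<open>C\<close> cannot also reach \<open>D\<close>.\<close>

lemma components_disjoint_Union:
  fixes \<C> :: "'a::topological_space set set"
  assumes fin: "finite \<C>" and cl: "\<And>C. C \<in> \<C> \<Longrightarrow> closed C" and con: "\<And>C. C \<in> \<C> \<Longrightarrow> connected C"
    and ne: "{} \<notin> \<C>" and dis: "disjoint \<C>"
  shows "components (\<Union>\<C>) = \<C>"
proof -
  have comp: "connected_component_set (\<Union>\<C>) x = C" if C: "C \<in> \<C>" "x \<in> C" for C x
  proof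
    show "C \<subseteq> connected_component_set (\<Union>\<C>) x"
      using C con by (intro connected_component_maximal) auto
    define K where "K = connected_component_set (\<Union>\<C>) x"
    have K: "connected K" "K \<subseteq> \<Union>\<C>" "x \<in> K"
      using C by (auto simp: K_def connected_component_subset)
    define D where "D = \<Union>(\<C> - {C})"
    have "closed D" unfolding D_def using fin cl by (intro closed_Union) auto
    moreover have "K \<subseteq> C \<union> D" using K(2) unfolding D_def by blast
    moreover have "C \<inter> D = {}" using dis C(1) unfolding D_def disjoint_def by blast
    ultimately have "D \<inter> K = {}"
      using connected_closedD[OF K(1), of C D] cl[OF C(1)] C(2) K(3) by blast
    then show "connected_component_set (\<Union>\<C>) x \<subseteq> C"
      using \<open>K \<subseteq> C \<union> D\<close> unfolding K_def by blast
  qed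
  have "components (\<Union>\<C>) \<subseteq> \<C>" using comp unfolding components_def by auto
  moreover have "C \<in> components (\<Union>\<C>)" if C: "C \<in> \<C>" for C
  proof -
    have "C \<noteq> {}" using C ne by metis
    then obtain x where "x \<in> C" by blast
    then show ?thesis using comp[OF C] C unfolding components_def by blast
  qed
  ultimately show ?thesis by blast
qed

lemma simple_closed_curve_topology:
  assumes "simple_closed_curve C" shows "compact C" "connected C" "C \<noteq> {}"
  using assms unfolding simple_closed_curve_def
  by (auto simp: simple_path_imp_path compact_path_image connected_path_image)

locale drawing =
  fixes n :: nat and L R :: "nat \<Rightarrow> real" and \<sigma> \<tau> :: "nat \<Rightarrow> nat" and u l :: "nat \<Rightarrow> real \<Rightarrow> complex"
  assumes mp: "meander_points n L R" and \<sigma>: "\<sigma> permutes {1..n}" and \<tau>: "\<tau> permutes {1..n}"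
    and drawing: "meander_drawing n L R \<sigma> \<tau> u l"
begin

lemma \<sigma>_in: "x \<in> {1..n} \<Longrightarrow> \<sigma> x \<in> {1..n}" and \<tau>_in: "x \<in> {1..n} \<Longrightarrow> \<tau> x \<in> {1..n}"
  using permutes_in_image[OF \<sigma>] permutes_in_image[OF \<tau>] by blast+

lemma
  assumes "x \<in> {1..n}"
  shows arc_u: "arc (u x)" and start_u: "pathstart (u x) = complex_of_real (R x)"
    and finish_u: "pathfinish (u x) = complex_of_real (L (\<sigma> x))"
    and arc_l: "arc (l x)" and start_l: "pathstart (l x) = complex_of_real (R x)"
    and finish_l: "pathfinish (l x) = complex_of_real (L (\<tau> x))"
  using drawing assms unfolding meander_drawing_def arc_family_def by blast+

lemma
  assumes "x \<in> {1..n}" "y \<in> {1..n}" "x \<noteq> y"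
  shows u_disjoint: "path_image (u x) \<inter> path_image (u y) = {}"
    and l_disjoint: "path_image (l x) \<inter> path_image (l y) = {}"
  using drawing assms unfolding meander_drawing_def arc_family_def disjoint_family_on_def by blast+

text \<open>The arcs without their ends lie in opposite open half-planes, so only common end points
  remain. As all positions are distinct, such a point is a common \<open>R\<close> or a common
  \<open>L\<close>.\<close>

lemma u_l_meet:
  assumes xy: "x \<in> {1..n}" "y \<in> {1..n}" and z: "z \<in> path_image (u x)" "z \<in> path_image (l y)"
  shows "x = y \<and> z = complex_of_real (R x) \<or> \<sigma> x = \<tau> y \<and> z = complex_of_real (L (\<sigma> x))"
proof -
  have u: "z = complex_of_real (R x) \<or> z = complex_of_real (L (\<sigma> x)) \<or> Im z > 0"
    using drawing xy z start_u finish_u unfolding meander_drawing_def arc_family_def by blast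
  have l: "z = complex_of_real (R y) \<or> z = complex_of_real (L (\<tau> y)) \<or> Im z < 0"
    using drawing xy z start_l finish_l unfolding meander_drawing_def arc_family_def by blast
  show ?thesis
    using u l meander_points_distinct(2)[OF mp xy] meander_points_distinct(1)[OF mp \<sigma>_in[OF xy(1)] \<tau>_in[OF xy(2)]]
      meander_points_distinct(3)[OF mp \<sigma>_in[OF xy(1)] xy(2)] meander_points_distinct(3)[OF mp \<tau>_in[OF xy(2)] xy(1)]
    by auto
qed

definition next_point :: "nat \<Rightarrow> nat" where
  "next_point = inv \<tau> \<circ> \<sigma>"

lemma next_point_permutes: "next_point permutes {1..n}"
  unfolding next_point_def using permutes_compose[OF \<sigma> permutes_inv[OF \<tau>]] .

lemma permutation_next_point: "permutation next_point"
  using next_point_permutes permutation_permutes by blast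

lemma \<tau>_next_point: "\<tau> (next_point x) = \<sigma> x"
  using permutes_inverses(1)[OF \<tau>] by (simp add: next_point_def)

definition loop :: "nat set \<Rightarrow> complex set" where
  "loop A = (\<Union>y\<in>A. path_image (u y) \<union> path_image (l y))"

text \<open>The curve runs along \<open>u (y 0)\<close>, backwards along \<open>l (y 1)\<close>,
  along \<open>u (y 1)\<close>, and so on. The arc \<open>l x\<close> is held back to close the
  loop, since \<open>y m = y 0 = x\<close>.\<close>

lemma simple_closed_curve_loop:
  assumes x: "x \<in> {1..n}"
  shows "simple_closed_curve (loop (orbit next_point x))"
proof -
  define m where "m = funpow_dist1 next_point x x"
  define y where "y k = (next_point ^^ k) x" for k
  have xo: "x \<in> orbit next_point x" using permutation_self_in_orbit[OF permutation_next_point] .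
  have y0: "y 0 = x" and ym: "y m = x"
    using funpow_dist1_prop[OF xo] by (simp_all add: y_def m_def)
  have yS: "y k \<in> {1..n}" for k
    unfolding y_def using permutes_in_image[OF permutes_funpow[OF next_point_permutes]] x by blast
  have yeq: "y j = y k \<longleftrightarrow> j = k" if "j < m" "k < m" for j k
    using funpow_neq_less_funpow_dist1[OF xo, of j k] that unfolding y_def m_def by blast
  have orb: "orbit next_point x = y ` {..<m}"
    unfolding orbit_conv_funpow_dist1[OF xo] by (simp add: y_def m_def atLeast0LessThan del: funpow.simps)
  have \<tau>y: "\<tau> (y (Suc k)) = \<sigma> (y k)" for k using \<tau>_next_point by (simp add: y_def)
  have \<sigma>eq: "\<sigma> a = \<sigma> b \<longleftrightarrow> a = b" for a b using permutes_inj[OF \<sigma>] by (auto dest: injD)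
  \<comment> \<open>Lower arcs are indexed from \<open>1\<close>: with one upper arc more than lower
    arcs, the union is an open arc from an \<open>R\<close> to an \<open>L\<close>, and only the
    final join is cyclic.\<close>
  have "\<exists>g. arc g \<and> pathstart g = complex_of_real (R x) \<and> pathfinish g = complex_of_real (L (\<sigma> (y k))) \<and>
      path_image g = (\<Union>j\<in>{..k}. path_image (u (y j))) \<union> (\<Union>j\<in>{1..k}. path_image (l (y j)))"
    if "k < m" for k
    using that
  proof (induction k)
    case 0
    show ?case using arc_u[OF x] start_u[OF x] finish_u[OF x] y0 by (intro exI[of _ "u x"]) simp
  next
    case (Suc k)
    then obtain g where g: "arc g" "pathstart g = complex_of_real (R x)"
      "pathfinish g = complex_of_real (L (\<sigma> (y k)))"
      "path_image g = (\<Union>j\<in>{..k}. path_image (u (y j))) \<union> (\<Union>j\<in>{1..k}. path_image (l (y j)))"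
      by auto
    define w where "w = y (Suc k)"
    have w: "w \<in> {1..n}" using yS by (simp add: w_def)
    have wj: "y j \<noteq> w" if "j \<le> k" for j using yeq[of j "Suc k"] that Suc.prems by (simp add: w_def)
    define h where "h = g +++ reversepath (l w)"
    have gh: "pathfinish g = pathstart (reversepath (l w))"
      using finish_l[OF w] \<tau>y g by (simp add: w_def)
    \<comment> \<open>A point shared with an earlier upper arc must be an \<open>L\<close>, since a
      shared \<open>R\<close> would identify two distinct indices.\<close>
    have "path_image g \<inter> path_image (reversepath (l w)) \<subseteq> {pathstart (reversepath (l w))}"
    proof
      fix z assume z: "z \<in> path_image g \<inter> path_image (reversepath (l w))"
      then have zl: "z \<in> path_image (l w)" by simp
      have "z \<notin> path_image (l (y j))" if "j \<in> {1..k}" for j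
        using l_disjoint[OF yS w wj, of j] that zl by auto
      then obtain j where j: "j \<le> k" "z \<in> path_image (u (y j))" using z g(4) by auto
      then have "\<sigma> (y j) = \<tau> w" "z = complex_of_real (L (\<sigma> (y j)))"
        using u_l_meet[OF yS w j(2) zl] wj by auto
      then show "z \<in> {pathstart (reversepath (l w))}" using finish_l[OF w] by simp
    qed
    then have h: "arc h" unfolding h_def using arc_join[OF g(1) arc_reversepath[OF arc_l[OF w]] gh] by simp
    have h_im: "path_image h = path_image g \<union> path_image (l w)"
      unfolding h_def using path_image_join[OF gh] by simp
    have hu: "pathfinish h = pathstart (u w)"
      using start_u[OF w] start_l[OF w] by (simp add: h_def)
    have hu_meet: "path_image h \<inter> path_image (u w) \<subseteq> {pathstart (u w)}"
    proof
      fix z assume z: "z \<in> path_image h \<inter> path_image (u w)"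
      have "z \<notin> path_image (u (y j))" if "j \<le> k" for j
        using u_disjoint[OF yS w wj[OF that]] z by auto
      then obtain j where j: "j \<in> {1..Suc k}" "z \<in> path_image (l (y j))"
        using z unfolding h_im g(4) w_def by fastforce
      obtain i where i: "j = Suc i" using j(1) by (cases j) auto
      \<comment> \<open>\<open>\<tau> (y j)\<close> is \<open>\<sigma> (y i)\<close> for an earlier
        index \<open>i\<close>, so the new upper arc can meet \<open>l (y j)\<close> only in an
        \<open>R\<close>.\<close>
      have "\<sigma> w \<noteq> \<tau> (y j)"
        using j(1) wj[of i] unfolding i \<tau>y \<sigma>eq by auto
      then show "z \<in> {pathstart (u w)}"
        using u_l_meet[OF w yS, of z j] z j start_u[OF w] by auto
    qed
    have ivl: "{1..Suc k} = insert (Suc k) {1..k}" by auto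
    have "arc (h +++ u w)" using arc_join[OF h arc_u[OF w] hu hu_meet] .
    moreover have "path_image (h +++ u w) =
      (\<Union>j\<in>{..Suc k}. path_image (u (y j))) \<union> (\<Union>j\<in>{1..Suc k}. path_image (l (y j)))"
      unfolding path_image_join[OF hu] h_im g(4) atMost_Suc ivl UN_insert
      unfolding w_def by (simp only: Un_ac)
    moreover have "pathstart (h +++ u w) = complex_of_real (R x)"
      "pathfinish (h +++ u w) = complex_of_real (L (\<sigma> (y (Suc k))))"
      using g(2) finish_u[OF w] by (simp_all add: h_def w_def)
    ultimately show ?case by blast
  qed
  then obtain g where g: "arc g" "pathstart g = complex_of_real (R x)"
      "pathfinish g = complex_of_real (L (\<sigma> (y (m - 1))))"
      "path_image g = (\<Union>j\<in>{..m - 1}. path_image (u (y j))) \<union> (\<Union>j\<in>{1..m - 1}. path_image (l (y j)))"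
    unfolding m_def by (metis diff_Suc_1 lessI)
  have m: "m = Suc (m - 1)" by (simp add: m_def)
  have \<tau>x: "\<tau> x = \<sigma> (y (m - 1))" using \<tau>y[of "m - 1"] m ym by simp
  have g_l: "pathfinish g = pathstart (reversepath (l x))" "pathfinish (reversepath (l x)) = pathstart g"
    using finish_l[OF x] start_l[OF x] \<tau>x g by simp_all
  \<comment> \<open>Now both ends of \<open>l x\<close> may be shared: \<open>R x\<close> at the
    start of \<open>g\<close> and \<open>L (\<tau> x)\<close> at its end.\<close>
  have "path_image g \<inter> path_image (reversepath (l x)) \<subseteq> {pathstart g, pathstart (reversepath (l x))}"
  proof
    fix z assume z: "z \<in> path_image g \<inter> path_image (reversepath (l x))"
    then have zl: "z \<in> path_image (l x)" by simp
    have "z \<notin> path_image (l (y j))" if "j \<in> {1..m - 1}" for j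
      using l_disjoint[OF yS x, of j] yeq[of j 0] y0 that zl by auto
    then obtain j where j: "z \<in> path_image (u (y j))" using z g(4) by auto
    show "z \<in> {pathstart g, pathstart (reversepath (l x))}"
      using u_l_meet[OF yS x j zl] g(2) finish_l[OF x] by auto
  qed
  then have "simple_path (g +++ reversepath (l x))"
    using simple_path_join_loop[OF g(1) arc_reversepath[OF arc_l[OF x]] g_l] by simp
  moreover have "pathfinish (g +++ reversepath (l x)) = pathstart (g +++ reversepath (l x))"
    using g_l by simp
  moreover have "path_image (g +++ reversepath (l x)) = loop (orbit next_point x)"
  proof -
    have "{..m - 1} = {..<m}" using m by auto
    moreover have "insert 0 {1..m - 1} = {..<m}" using m by auto
    then have "(\<Union>j\<in>{..<m}. path_image (l (y j))) = path_image (l x) \<union> (\<Union>j\<in>{1..m - 1}. path_image (l (y j)))"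
      using y0 by (metis UN_insert)
    ultimately show ?thesis
      unfolding path_image_join[OF g_l(1)] g(4) loop_def orb by auto
  qed
  ultimately show ?thesis unfolding simple_closed_curve_def by blast
qed

text \<open>Arcs sharing an \<open>R\<close> have equal indices, and an upper and a lower arc
  sharing an \<open>L\<close> have indices linked by \<open>next_point\<close>; in both cases the
  orbits coincide.\<close>

lemma loops_disjoint:
  assumes "x \<in> {1..n}" "y \<in> {1..n}" "orbit next_point x \<noteq> orbit next_point y"
  shows "loop (orbit next_point x) \<inter> loop (orbit next_point y) = {}"
proof -
  note eq = orbit_eq_of_mem[OF permutation_next_point]
  have False if ab: "a \<in> orbit next_point x" "b \<in> orbit next_point y"
    and z: "z \<in> path_image (u a) \<union> path_image (l a)" "z \<in> path_image (u b) \<union> path_image (l b)" for a b z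
  proof -
    have oab: "orbit next_point a \<noteq> orbit next_point b" using eq[OF ab(1)] eq[OF ab(2)] assms by simp
    have S: "a \<in> {1..n}" "b \<in> {1..n}"
      using permutes_orbit_subset[OF next_point_permutes] assms ab by blast+
    have "a \<noteq> b" using oab by auto
    have nxt: "\<sigma> c \<noteq> \<tau> d" if "orbit next_point c \<noteq> orbit next_point d" for c d
    proof
      assume "\<sigma> c = \<tau> d"
      then have "next_point c = d" using permutes_inverses(2)[OF \<tau>] by (simp add: next_point_def)
      then show False using that permutation_orbit_step[OF permutation_next_point, of c] by simp
    qed
    show False
      using z u_disjoint[OF S \<open>a \<noteq> b\<close>] l_disjoint[OF S \<open>a \<noteq> b\<close>] u_l_meet[OF S, of z] u_l_meet[OF S(2,1), of z]
        nxt[OF oab] nxt[OF oab[symmetric]] \<open>a \<noteq> b\<close> by blast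
  qed
  then show ?thesis unfolding loop_def by blast
qed

text \<open>Distinct orbits give disjoint nonempty loops, so \<open>loop\<close> is injective on
  orbits, and counting components amounts to counting cycles.\<close>

lemma
  shows card_components: "card (components (meander_system n u l)) = cyc n \<sigma> \<tau>"
    and components_simple: "C \<in> components (meander_system n u l) \<Longrightarrow> simple_closed_curve C"
proof -
  have scc: "simple_closed_curve (loop A)" if "A \<in> orbits {1..n} next_point" for A
    using that simple_closed_curve_loop by (auto simp: orbits_def)
  have self: "x \<in> orbit next_point x" for x using permutation_self_in_orbit[OF permutation_next_point] .
  have "\<Union>(orbits {1..n} next_point) = {1..n}"
  proof
    show "\<Union>(orbits {1..n} next_point) \<subseteq> {1..n}"
      unfolding orbits_def using permutes_orbit_subset[OF next_point_permutes] by (intro UN_least)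
    show "{1..n} \<subseteq> \<Union>(orbits {1..n} next_point)"
      unfolding orbits_def using self by blast
  qed
  then have sys: "meander_system n u l = \<Union>(loop ` orbits {1..n} next_point)"
    unfolding meander_system_def loop_def by blast
  have dis: "loop A \<inter> loop B = {}" if "A \<in> orbits {1..n} next_point" "B \<in> orbits {1..n} next_point" "A \<noteq> B" for A B
    using that unfolding orbits_def by (elim imageE) (use loops_disjoint in simp)
  have *: "components (meander_system n u l) = loop ` orbits {1..n} next_point"
    unfolding sys
  proof (rule components_disjoint_Union)
    show "disjoint (loop ` orbits {1..n} next_point)"
      unfolding disjoint_def using dis by blast
    show "finite (loop ` orbits {1..n} next_point)" by (simp add: orbits_def)
    show "closed C" "connected C" if "C \<in> loop ` orbits {1..n} next_point" for C
      using that simple_closed_curve_topology(1,2)[OF scc] compact_imp_closed by blast+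
    show "{} \<notin> loop ` orbits {1..n} next_point"
      using simple_closed_curve_topology(3)[OF scc] by fastforce
  qed
  show "simple_closed_curve C" if "C \<in> components (meander_system n u l)"
    using that scc unfolding * by blast
  have "inj_on loop (orbits {1..n} next_point)"
    using dis simple_closed_curve_topology(3)[OF scc] by (intro inj_onI) (metis inf.idem)
  then show "card (components (meander_system n u l)) = cyc n \<sigma> \<tau>"
    unfolding * by (simp add: card_image cyc_def next_point_def)
qed

end

theorem theorem3p2:
  fixes n :: nat and \<sigma> \<tau> :: "nat \<Rightarrow> nat" and L R :: "nat \<Rightarrow> real"
  assumes "n \<ge> 1"
    and "\<sigma> \<in> Lambda n" and "\<tau> \<in> Lambda n"
    and "meander_points n L R"
  shows "Lambda_dist n \<sigma> \<tau> = graph_dist (cayley_edges n \<inter> Lambda n \<times> Lambda n) \<sigma> \<tau> \<and>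
    (\<exists>u l. meander_drawing n L R \<sigma> \<tau> u l) \<and>
    (\<forall>u l. meander_drawing n L R \<sigma> \<tau> u l \<longrightarrow>
       (\<forall>C\<in>components (meander_system n u l). simple_closed_curve C) \<and>
       (\<forall>k::int.
          (int (card (components (meander_system n u l))) = k
             \<longleftrightarrow> int (cayley_dist n \<sigma> \<tau>) = int n - k) \<and>
          (int (cayley_dist n \<sigma> \<tau>) = int n - k
             \<longleftrightarrow> int (Lambda_dist n \<sigma> \<tau>) = int n - k)) \<and>
       (simple_closed_curve (meander_system n u l)
          \<longleftrightarrow> cayley_dist n \<sigma> \<tau> = n - 1 \<and> Lambda_dist n \<sigma> \<tau> = n - 1))"
proof -
  have perm: "\<sigma> permutes {1..n}" "\<tau> permutes {1..n}"
    using assms(2,3) NCD(1) sigma_permutes unfolding Lambda_def by blast+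
  have dist: "Lambda_dist n \<sigma> \<tau> = n - cyc n \<sigma> \<tau>" "cayley_dist n \<sigma> \<tau> = n - cyc n \<sigma> \<tau>"
    "graph_dist (cayley_edges n \<inter> Lambda n \<times> Lambda n) \<sigma> \<tau> = n - cyc n \<sigma> \<tau>"
    unfolding Lambda_dist_def cayley_dist_def
    using dist_eq_cyc[OF assms(2,3)] hasse_subset_cayley[of n] by auto
  have cn: "cyc n \<sigma> \<tau> \<le> n" by (rule cyc_le)
  have curve: "simple_closed_curve (meander_system n u l) \<longleftrightarrow> cyc n \<sigma> \<tau> = 1"
    and comps: "\<forall>C\<in>components (meander_system n u l). simple_closed_curve C"
    and card: "card (components (meander_system n u l)) = cyc n \<sigma> \<tau>"
    if d: "meander_drawing n L R \<sigma> \<tau> u l" for u l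
  proof -
    interpret drawing n L R \<sigma> \<tau> u l using assms(4) perm d by unfold_locales
    show comps: "\<forall>C\<in>components (meander_system n u l). simple_closed_curve C"
      using components_simple by blast
    show card: "card (components (meander_system n u l)) = cyc n \<sigma> \<tau>" by (rule card_components)
    show "simple_closed_curve (meander_system n u l) \<longleftrightarrow> cyc n \<sigma> \<tau> = 1"
    proof
      assume "simple_closed_curve (meander_system n u l)"
      then have "components (meander_system n u l) = {meander_system n u l}"
        using simple_closed_curve_topology components_eq_sing_iff by blast
      then show "cyc n \<sigma> \<tau> = 1" using card by simp
    next
      assume "cyc n \<sigma> \<tau> = 1"
      then obtain C where C: "components (meander_system n u l) = {C}"
        using card by (metis card_1_singletonE)
      then have "meander_system n u l = C" using Union_components[of "meander_system n u l"] by simp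
      then show "simple_closed_curve (meander_system n u l)" using comps C by simp
    qed
  qed
  \<comment> \<open>The bound \<open>1 \<le> n\<close> enters here: for \<open>n = 0\<close>
    truncated subtraction would let a count of \<open>0\<close> satisfy the right-hand side.\<close>
  have "cyc n \<sigma> \<tau> = 1 \<longleftrightarrow> n - cyc n \<sigma> \<tau> = n - 1"
    using cn assms(1)
    by linarith
  then show ?thesis
    using meander_drawing_exists[OF assms(2-4)] curve comps card cn
    unfolding dist by (auto simp: of_nat_diff)
qed


end
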